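(* Let $k\ge 1$, let $A\in GL_k(\mathbf{Q})\cap M_k(\mathbf{Z})$ have eigenvalues $\lambda_1,\dots,\lambda_k\in\mathbf{C}^{*}$ (with multiplicity) such that for every $i=1,\dots,k$ there is an integer $l_i\ge 1$ with $\lambda_i^{l_i}\in\mathbf{N}$ and $\lambda_i^{l_i}\ge 2$. Let $\mu$ be a probability distribution on $\mathbf{Z}^k$ whose support is not parallel to a proper subspace of $\mathbf{Q}^k$ invariant under $A$, let $\{\mathbf{B}_n\}_{n\ge 0}$ be independent random vectors in $\mathbf{Z}^k$ with common law $\mu$, and let $\mathbf{x}_0\in\mathbf{Z}^k$. For each modulus $p$ let $\mathbf{X}_{n+1}=A\mathbf{X}_n+\mathbf{B}_n$ (mod $p$), $\mathbf{X}_0=\mathbf{x}_0$, and let $P_n$ be the law of $\mathbf{X}_n$ on $\mathbf{Z}_p^k$. Let $B=(\mathbf{y}_1\,\dots\,\mathbf{y}_k)$ be a matrix whose columns form a basis of $\mathbf{Q}^k$ contained in $V^{d-1}$. Then there exist $c\in\mathbf{R}^{+}$ and a function $\varepsilon$ with $\lim_{p\to\infty}\varepsilon(p)=0$ such that, for all integers $p\ge 2$ with $\gcd(\det(A),p)=\gcd(\det(B),p)=1$ and all integers $n\ge 0$ with $n\ge c\,\ln p\,\ln\ln p$, $$\|P_n-U\|\le \varepsilon(p).$$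
   Context: $\mathbf{Z}_p^k=(\mathbf{Z}/p\mathbf{Z})^k$; $U$ is the uniform distribution on $\mathbf{Z}_p^k$; $\|P_n-U\|=\frac12\sum_{\mathbf{x}\in\mathbf{Z}_p^k}|P_n(\mathbf{x})-U(\mathbf{x})|$ is the variation distance. $d\le k$ is the degree of the minimum polynomial of $A$. The support of $\mu$ is parallel to a subspace $W\subset\mathbf{Q}^k$ if it is contained in some translate $\mathbf{v}+W$; "proper" means $W\neq\mathbf{Q}^k$ (so $W=\{\mathbf 0\}$ is allowed). Set $V=\{\mathbf{h}-\mathbf{k}:\mathbf{h},\mathbf{k}\in\operatorname{supp}\mu\}$ and $V^{d-1}=\{A^m\mathbf{x}:\mathbf{x}\in V,\ m=0,1,\dots,d-1\}$. Under the hypothesis on the support of $\mu$, $V^{d-1}$ contains a basis of $\mathbf{Q}^k$; one such basis $\{\mathbf{y}_1,\dots,\mathbf{y}_k\}$ is fixed and $B$ is the integer matrix with these columns. The matrix $A$, the law $\mu$ and the vector $\mathbf{x}_0$ do not depend on $p$. *)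

theory Defs
  imports "HOL-Probability.Probability" "HOL-Computational_Algebra.Polynomial"
begin

section \<open>Linear algebra\<close>

abbreviation of_int_mat :: "int ^ 'k ^ 'k \<Rightarrow> 'a::ring_1 ^ 'k ^ 'k" where
  "of_int_mat \<equiv> map_matrix of_int"

definition of_int_vec :: "int ^ 'k \<Rightarrow> 'a::ring_1 ^ 'k" where
  "of_int_vec x = (\<chi> i. of_int (x $ i))"

definition eigenvalue :: "'a::field ^ 'k ^ 'k \<Rightarrow> 'a \<Rightarrow> bool" where
  "eigenvalue A c \<longleftrightarrow> (\<exists>v. v \<noteq> 0 \<and> A *v v = c *s v)"

fun mat_power :: "'a::semiring_1 ^ 'k ^ 'k \<Rightarrow> nat \<Rightarrow> 'a ^ 'k ^ 'k" where
  "mat_power A 0 = mat 1"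
| "mat_power A (Suc n) = A ** mat_power A n"

definition poly_mat :: "'a::comm_ring_1 poly \<Rightarrow> 'a ^ 'k ^ 'k \<Rightarrow> 'a ^ 'k ^ 'k" where
  "poly_mat q A = (\<Sum>l\<le>degree q. mat (coeff q l) ** mat_power A l)"

definition is_min_poly :: "'a::field ^ 'k ^ 'k \<Rightarrow> 'a poly \<Rightarrow> bool" where
  "is_min_poly A q \<longleftrightarrow> lead_coeff q = 1 \<and> poly_mat q A = 0 \<and>
     (\<forall>r. r \<noteq> 0 \<and> poly_mat r A = 0 \<longrightarrow> degree q \<le> degree r)"

definition min_poly :: "'a::field ^ 'k ^ 'k \<Rightarrow> 'a poly" where
  "min_poly A = (THE q. is_min_poly A q)"

lemma mat_mult_nth: "(mat c ** (M :: 'a::comm_ring_1 ^ 'k ^ 'k)) $ i $ j = c * M $ i $ j"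
  by (simp add: matrix_matrix_mult_def mat_def if_distrib[of "\<lambda>x. x * _"] cong: if_cong)

lemma poly_mat_nth:
  assumes "degree q \<le> n"
  shows "poly_mat q A $ i $ j = (\<Sum>l\<le>n. coeff q l * mat_power A l $ i $ j)"
proof -
  have "poly_mat q A $ i $ j = (\<Sum>l\<le>degree q. coeff q l * mat_power A l $ i $ j)"
    by (simp add: poly_mat_def mat_mult_nth)
  also have "\<dots> = (\<Sum>l\<le>n. coeff q l * mat_power A l $ i $ j)"
    using assms by (intro sum.mono_neutral_left) (auto simp: coeff_eq_0)
  finally show ?thesis .
qed

lemma poly_mat_smult: "poly_mat q A = 0 \<Longrightarrow> poly_mat (smult c q) A = 0"
  using poly_mat_nth[OF order_refl, of q A] poly_mat_nth[OF degree_smult_le, of c q A]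
  by (auto simp: vec_eq_iff mult.assoc simp flip: sum_distrib_left)

lemma poly_mat_diff:
  assumes "poly_mat q A = 0" "poly_mat r A = 0"
  shows "poly_mat (q - r) A = 0"
proof -
  let ?n = "max (degree q) (degree r)"
  have "poly_mat (q - r) A $ i $ j = poly_mat q A $ i $ j - poly_mat r A $ i $ j" for i j
    using degree_diff_le_max[of q r]
    by (simp add: poly_mat_nth[of _ ?n] left_diff_distrib sum_subtractf)
  then show ?thesis using assms by (simp add: vec_eq_iff)
qed

lemma poly_mat_exists: "\<exists>q. q \<noteq> 0 \<and> poly_mat q (A :: 'a::field ^ 'k ^ 'k) = 0"
proof -
  define f :: "nat \<Rightarrow> 'a ^ ('k \<times> 'k)" where
    "f l = (\<chi> p. mat_power A l $ fst p $ snd p)" for l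
  define n where "n = CARD('k \<times> 'k)"
  have "\<exists>u. (\<exists>l\<le>n. u l \<noteq> 0) \<and> (\<Sum>l\<le>n. u l *s f l) = 0"
  proof (cases "inj_on f {..n}")
    case True
    have "card (f ` {..n}) > n" using True by (simp add: card_image)
    then have "vec.dependent (f ` {..n})"
      using vec.independent_card_le_dim[of "f ` {..n}" UNIV] 
      by (auto simp: card_cart_basis n_def)
    then obtain u where u: "(\<Sum>v\<in>f ` {..n}. u v *s v) = 0" "\<exists>v\<in>f ` {..n}. u v \<noteq> 0"
      using vec.dependent_finite[of "f ` {..n}"] by auto
    have "(\<Sum>l\<le>n. u (f l) *s f l) = 0" using u(1) True by (simp add: sum.reindex)
    then show ?thesis using u(2) by (intro exI[of _ "u \<circ> f"]) auto
  next
    case False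
    then obtain a b where ab: "a \<le> n" "b \<le> n" "a \<noteq> b" "f a = f b" by (auto simp: inj_on_def)
    let ?u = "\<lambda>l. if l = a then 1 else if l = b then - 1 else (0::'a)"
    have "(\<Sum>l\<le>n. ?u l *s f l) = (\<Sum>l\<in>{a, b}. ?u l *s f l)"
      using ab by (intro sum.mono_neutral_right) auto
    also have "\<dots> = 0" using ab by simp
    finally show ?thesis using ab by (intro exI[of _ ?u]) auto
  qed
  then obtain u where u: "\<exists>l\<le>n. u l \<noteq> 0" "(\<Sum>l\<le>n. u l *s f l) = 0" by blast
  define q where "q = (\<Sum>l\<le>n. monom (u l) l)"
  have cq: "coeff q l = (if l \<le> n then u l else 0)" for l
    by (simp add: q_def coeff_sum if_distrib[of "\<lambda>x. x = _"])
  have "degree q \<le> n" by (rule degree_le) (simp add: cq)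
  then have "poly_mat q A $ i $ j = (\<Sum>l\<le>n. u l *s f l) $ (i, j)" for i j
    by (simp add: poly_mat_nth cq f_def)
  then have "poly_mat q A = 0" by (simp add: u vec_eq_iff)
  moreover have "q \<noteq> 0" using u(1) cq by (metis coeff_0)
  ultimately show ?thesis by blast
qed

lemma is_min_poly_min_poly: "is_min_poly A (min_poly A)"
proof -
  let ?P = "\<lambda>q. q \<noteq> 0 \<and> poly_mat q A = 0"
  obtain q where q: "?P q" "\<And>r. ?P r \<Longrightarrow> degree q \<le> degree r"
    using poly_mat_exists[of A] ex_has_least_nat[of ?P _ degree] by metis
  have "is_min_poly A (smult (inverse (lead_coeff q)) q)"
    using q poly_mat_smult[of q A] by (auto simp: is_min_poly_def)
  moreover have "r = s" if "is_min_poly A r" "is_min_poly A s" for r s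
  proof (rule ccontr)
    assume "r \<noteq> s"
    moreover have "poly_mat (r - s) A = 0"
      using that by (intro poly_mat_diff) (auto simp: is_min_poly_def)
    ultimately have le: "degree r \<le> degree (r - s)" using that by (auto simp: is_min_poly_def)
    have nz: "r \<noteq> 0" "s \<noteq> 0" using that by (auto simp: is_min_poly_def)
    have eq: "degree r = degree s" using that nz by (meson is_min_poly_def le_antisym)
    then have "degree (r - s) \<le> degree r" using degree_diff_le_max[of r s] by simp
    with le have "degree (r - s) = degree r" by simp
    moreover have "coeff (r - s) (degree r) = 0" using that eq by (simp add: is_min_poly_def)
    ultimately have "r - s = 0" by (metis leading_coeff_0_iff)
    with \<open>r \<noteq> s\<close> show False by simp
  qed
  ultimately have "\<exists>!q. is_min_poly A q" by blast
  then show ?thesis unfolding min_poly_def by (rule theI')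
qed

definition is_basis :: "('k \<Rightarrow> 'a::field ^ 'k) \<Rightarrow> bool" where
  "is_basis y \<longleftrightarrow> inj y \<and> vec.independent (range y) \<and> vec.span (range y) = UNIV"

definition invariant_under :: "'a::field ^ 'k ^ 'k \<Rightarrow> ('a ^ 'k) set \<Rightarrow> bool" where
  "invariant_under A W \<longleftrightarrow> (\<forall>w\<in>W. A *v w \<in> W)"

definition parallel_to :: "('a::field ^ 'k) set \<Rightarrow> ('a ^ 'k) set \<Rightarrow> bool" where
  "parallel_to S W \<longleftrightarrow> (\<exists>v. S \<subseteq> (\<lambda>w. v + w) ` W)"

definition supp_differences :: "(int ^ 'k) pmf \<Rightarrow> (int ^ 'k) set" where
  "supp_differences \<mu> = {h - k | h k. h \<in> set_pmf \<mu> \<and> k \<in> set_pmf \<mu>}"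

text \<open>The set \<open>V\<^sup>d\<^sup>-\<^sup>1\<close>, where \<open>d\<close> is the degree of the minimum polynomial of \<open>A\<close> over the rationals.\<close>

definition supp_orbit :: "int ^ 'k ^ 'k \<Rightarrow> (int ^ 'k) pmf \<Rightarrow> (int ^ 'k) set" where
  "supp_orbit A \<mu> = {mat_power A m *v x | m x.
     x \<in> supp_differences \<mu> \<and> m < degree (min_poly (of_int_mat A :: rat ^ 'k ^ 'k))}"

section \<open>The random walk modulo \<open>p\<close>\<close>

text \<open>Elements of \<open>(\<int>/p\<int>)\<^sup>k\<close> are represented by the integer vectors with all entries in
  \<open>{0..<p}\<close>.\<close>

definition residue_vectors :: "nat \<Rightarrow> (int ^ 'k) set" where
  "residue_vectors p = {x. \<forall>i. x $ i \<in> {0..<int p}}"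

definition vec_mod :: "int ^ 'k \<Rightarrow> nat \<Rightarrow> int ^ 'k" where
  "vec_mod x p = (\<chi> i. x $ i mod int p)"

fun walk :: "int ^ 'k ^ 'k \<Rightarrow> (nat \<Rightarrow> 'w \<Rightarrow> int ^ 'k) \<Rightarrow> int ^ 'k \<Rightarrow> nat \<Rightarrow> nat \<Rightarrow> 'w \<Rightarrow> int ^ 'k" where
  "walk A b x0 p 0 \<omega> = vec_mod x0 p"
| "walk A b x0 p (Suc n) \<omega> = vec_mod (A *v walk A b x0 p n \<omega> + b n \<omega>) p"

definition walk_law ::
  "'w measure \<Rightarrow> int ^ 'k ^ 'k \<Rightarrow> (nat \<Rightarrow> 'w \<Rightarrow> int ^ 'k) \<Rightarrow> int ^ 'k \<Rightarrow> nat \<Rightarrow> nat \<Rightarrow> int ^ 'k \<Rightarrow> real" where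
  "walk_law M A b x0 p n x = measure (distr M (count_space UNIV) (walk A b x0 p n)) {x}"

definition uniform_law :: "nat \<Rightarrow> int ^ 'k \<Rightarrow> real" where
  "uniform_law p = pmf (pmf_of_set (residue_vectors p))"

definition variation_distance :: "nat \<Rightarrow> (int ^ 'k \<Rightarrow> real) \<Rightarrow> (int ^ 'k \<Rightarrow> real) \<Rightarrow> real" where
  "variation_distance p P Q = 1 / 2 * (\<Sum>x\<in>residue_vectors p. \<bar>P x - Q x\<bar>)"

end

theory Submission
  imports Defs "HOL-Computational_Algebra.Fundamental_Theorem_Algebra"
begin

text \<open>
  The variation distance is bounded by Fourier analysis on the vectors modulo \<open>p\<close>. At a frequency
  \<open>\<alpha>\<close>, the transform of the law of \<open>X\<^sub>n\<close> has squared modulus \<open>\<Prod>j<n. f (\<alpha> A\<^sup>j)\<close>, where \<open>f\<close> is the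
  squared modulus of the characteristic function of \<open>\<mu>\<close>; so it suffices to show that the sum of
  these products over the nonzero frequencies is small (\<open>variation_distance_walk_bound\<close>). A factor
  is bounded away from \<open>1\<close> as soon as the orbit of \<open>\<alpha>/p\<close> leaves a neighbourhood of the integer
  points. A single orbit may need about \<open>ln p\<close> steps for that; the task is to gain
  enough in the sum after \<open>ln p * ln (ln p)\<close> steps.

  The eigenvalues have modulus greater than \<open>1\<close>, so some fixed power \<open>C = A\<^sup>s\<close> at least doubles the maximum
  norm of integer row vectors (\<open>expanding_power\<close>). Multiply \<open>\<alpha> C\<^sup>w\<close> by \<open>det B\<close>, reduce to symmetric
  residues, and call the result \<open>v\<^sub>w\<close>. The carries \<open>z\<^sub>w = (v\<^sub>w C - v\<^sub>w\<^sub>+\<^sub>1) / p\<close> are the digits of an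
  expansion of \<open>\<alpha>/p\<close> in the matrix base \<open>C\<close>. They come from a finite alphabet that does not depend on \<open>p\<close>, and
  the first \<open>t\<close> of them determine \<open>\<alpha>\<close> once \<open>2\<^sup>t > p\<close> (\<open>digit_inj\<close>). A nonzero digit means that
  \<open>v\<^sub>w\<close> is of order \<open>p\<close>. Through the adjugate of \<open>B\<close>, some column \<open>A\<^sup>m (h - k)\<close> of \<open>B\<close> then has a product with
  \<open>\<alpha> C\<^sup>w\<close> that is far from the multiples of \<open>p\<close>, so that \<open>f \<le> \<rho> < 1\<close> at time \<open>s w + m\<close>, inside the
  \<open>w\<close>-th block of length \<open>s\<close>.

  Hence the product over \<open>s t\<close> steps is at most \<open>\<rho>\<close> to the number of nonzero digits. Running through
  \<open>r\<close> such stretches replaces \<open>\<rho>\<close> by \<open>\<rho>\<^sup>r\<close>: the arithmetic-geometric mean inequality reduces the product of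
  the stretches to an \<open>r\<close>-th power, because multiplication by \<open>A\<close> permutes the frequencies
  (\<open>sum_prod_le_sum_block_power\<close>). Summing over all digit strings except the zero string gives
  at most \<open>(1 + K \<rho>\<^sup>r)\<^sup>t - 1\<close> (\<open>sum_char_pmf_bound\<close>). Here \<open>t\<close> is of order \<open>ln p\<close>, so \<open>r\<close> of order
  \<open>ln (ln p)\<close> makes \<open>t \<rho>\<^sup>r\<close> tend to \<open>0\<close>.
\<close>


section \<open>Powers of a matrix all of whose eigenvalues lie inside the unit disc\<close>

lemma mat_power_commute: "mat_power M n ** M = M ** mat_power M n"
  by (induction n) (simp_all add: matrix_mul_assoc[symmetric])

lemma mat_power_vec_Suc: "mat_power M (Suc n) *v v = mat_power M n *v (M *v v)"
  by (simp add: matrix_vector_mul_assoc mat_power_commute)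

lemma mat_power_add: "mat_power M (m + n) = mat_power M m ** mat_power M n"
  by (induction m) (simp_all add: matrix_mul_assoc)

lemma mat_power_commutes_with:
  "N ** M = M ** N \<Longrightarrow> N ** mat_power M n = mat_power M n ** N"
proof (induction n)
  case (Suc n)
  have "N ** mat_power M (Suc n) = M ** (N ** mat_power M n)"
    using Suc.prems by (simp add: matrix_mul_assoc)
  then show ?case using Suc by (simp add: matrix_mul_assoc)
qed simp

lemma mat_power_inverse:
  assumes "A ** M = mat 1"
  shows "mat_power A n ** mat_power M n = mat 1"
proof (induction n)
  case (Suc n)
  have "mat_power A (Suc n) ** mat_power M (Suc n) = A ** mat_power A n ** (mat_power M n ** M)"
    by (simp add: mat_power_commute)
  also have "\<dots> = A ** (mat_power A n ** mat_power M n) ** M"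
    by (simp add: matrix_mul_assoc)
  finally have "mat_power A (Suc n) ** mat_power M (Suc n) = \<dots>" .
  then show ?case using Suc assms by simp
qed simp

lemma mat_mult_vec: "mat c *v v = c *s (v :: 'a::comm_ring_1 ^ 'k)"
  by (simp add: matrix_vector_mult_def mat_def vec_eq_iff if_distrib[of "\<lambda>x. x * _"] cong: if_cong)

lemma mat_mult_commute: "mat c ** M = M ** mat (c :: 'a::field)"
  by (simp add: matrix_eq matrix_vector_mul_assoc[symmetric] mat_mult_vec vector_scalar_commute)

definition decays :: "complex ^ 'k ^ 'k \<Rightarrow> complex ^ 'k \<Rightarrow> bool" where
  "decays M v \<longleftrightarrow> (\<exists>K r. 0 < r \<and> r < 1 \<and> (\<forall>n. norm (mat_power M n *v v) \<le> K * r ^ n))"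

lemma norm_vector_scale: "norm (c *s v) = cmod c * norm (v :: complex ^ 'k)"
  by (simp add: norm_vec_def L2_set_right_distrib norm_mult)

lemma decays_commuting:
  assumes "decays M v" "N ** M = M ** N"
  shows "decays M (N *v v)"
proof -
  obtain K r where K: "0 < r" "r < 1" "\<And>n. norm (mat_power M n *v v) \<le> K * r ^ n"
    using assms(1) by (auto simp: decays_def)
  obtain L where L: "0 < L" "\<And>x. norm (N *v x) \<le> norm x * L"
    using bounded_linear.pos_bounded[OF matrix_vector_mul_bounded_linear[of N]] by auto
  have "norm (mat_power M n *v (N *v v)) \<le> (L * K) * r ^ n" for n
  proof -
    have "norm (mat_power M n *v (N *v v)) = norm (N *v (mat_power M n *v v))"
      using mat_power_commutes_with[OF assms(2), of n] by (simp add: matrix_vector_mul_assoc)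
    also have "\<dots> \<le> (K * r ^ n) * L"
      using L(2)[of "mat_power M n *v v"] K(3)[of n] L(1) by (smt (verit) mult_right_mono)
    finally show ?thesis by (simp add: mult_ac)
  qed
  then show ?thesis using K by (auto simp: decays_def)
qed

text \<open>Write \<open>a n\<close> for \<open>M\<^sup>n v\<close>. Then \<open>a (n + 1) = c a n + e n\<close> with a geometrically small
  \<open>e\<close>, which forces geometric decay at any rate beyond \<open>\<bar>c\<bar>\<close> and the rate of \<open>e\<close>.\<close>

lemma decays_eigenvalue_step:
  assumes "decays M ((M - mat c) *v v)" "cmod c < 1"
  shows "decays M v"
proof -
  obtain K q where q: "0 < q" "q < 1" "\<And>n. norm (mat_power M n *v ((M - mat c) *v v)) \<le> K * q ^ n"
    using assms(1) by (auto simp: decays_def)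
  define r where "r = (1 + max q (cmod c)) / 2"
  have r: "q \<le> r" "cmod c < r" "r < 1" "0 < r"
    using q assms(2) by (auto simp: r_def max_def)
  have K0: "0 \<le> K"
    using order_trans[OF norm_ge_zero q(3)[of 0]] by simp
  define L where "L = norm v + K / (r - cmod c)"
  have KL: "K \<le> L * (r - cmod c)"
    using r by (simp add: L_def distrib_right)
  have "norm (mat_power M n *v v) \<le> L * r ^ n" for n
  proof (induction n)
    case 0
    then show ?case using K0 r by (simp add: L_def)
  next
    case (Suc n)
    have eq: "mat_power M (Suc n) *v v
        = c *s (mat_power M n *v v) + mat_power M n *v ((M - mat c) *v v)"
    proof -
      have "M *v v = c *s v + (M - mat c) *v v"
        by (simp add: matrix_vector_mult_diff_rdistrib mat_mult_vec)
      then show ?thesis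
        unfolding mat_power_vec_Suc by (simp add: matrix_vector_right_distrib vector_scalar_commute)
    qed
    have "norm (mat_power M (Suc n) *v v) \<le> cmod c * (L * r ^ n) + K * q ^ n"
      unfolding eq using norm_triangle_ineq q(3)[of n] mult_left_mono[OF Suc, of "cmod c"]
      by (smt (verit) norm_vector_scale norm_ge_zero)
    also have "K * q ^ n \<le> L * (r - cmod c) * r ^ n"
      using KL K0 q r by (intro mult_mono power_mono) auto
    finally show ?case by (simp add: algebra_simps)
  qed
  then show ?thesis using r by (auto simp: decays_def)
qed

text \<open>If \<open>c\<close> is not an eigenvalue, then \<open>M - c\<close> is invertible and its inverse commutes with \<open>M\<close>, so
  decay passes back through it whatever the size of \<open>c\<close>.\<close>

lemma decays_root_step:
  fixes M :: "complex ^ 'k ^ 'k"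
  assumes "\<And>c. eigenvalue M c \<Longrightarrow> cmod c < 1" "decays M ((M - mat c) *v v)"
  shows "decays M v"
proof (cases "eigenvalue M c")
  case True
  then show ?thesis using decays_eigenvalue_step assms by blast
next
  case False
  have "w = 0" if "(M - mat c) *v w = 0" for w
    using False that by (auto simp: eigenvalue_def matrix_vector_mult_diff_rdistrib mat_mult_vec)
  then obtain N where N: "N ** (M - mat c) = mat 1"
    using matrix_left_invertible_ker by blast
  then have N': "(M - mat c) ** N = mat 1"
    using matrix_left_right_inverse by blast
  have cM: "(M - mat c) ** M = M ** (M - mat c)"
  proof -
    have "((M - mat c) ** M) *v x = (M ** (M - mat c)) *v x" for x
      by (simp add: matrix_vector_mul_assoc[symmetric] matrix_vector_mult_diff_rdistrib
          matrix_vector_mult_diff_distrib mat_mult_vec vector_scalar_commute)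
    then show ?thesis by (simp add: matrix_eq)
  qed
  have "N ** M = N ** (M ** ((M - mat c) ** N))" by (simp add: N')
  also have "\<dots> = N ** (M - mat c) ** M ** N" by (metis cM matrix_mul_assoc)
  finally have "N ** M = M ** N" by (simp add: N)
  with decays_commuting[OF assms(2), of N]
  show ?thesis by (simp add: matrix_vector_mul_assoc N)
qed

definition poly_apply :: "'a::field poly \<Rightarrow> 'a ^ 'k ^ 'k \<Rightarrow> 'a ^ 'k \<Rightarrow> 'a ^ 'k" where
  "poly_apply q M v = (\<Sum>l\<le>degree q. coeff q l *s (mat_power M l *v v))"

lemma poly_apply_upto:
  "degree q \<le> n \<Longrightarrow> poly_apply q M v = (\<Sum>l\<le>n. coeff q l *s (mat_power M l *v v))"
  unfolding poly_apply_def by (intro sum.mono_neutral_left) (auto simp: coeff_eq_0)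

lemma poly_mat_mult_vec:
  fixes M :: "'a::field ^ 'k ^ 'k"
  shows "poly_mat q M *v v = poly_apply q M v"
proof -
  have "(\<Sum>l\<in>S. F l) *v v = (\<Sum>l\<in>S. F l *v v)" if "finite S" for S and F :: "nat \<Rightarrow> 'a ^ 'k ^ 'k"
    using that by (induction S) (simp_all add: matrix_vector_mult_add_rdistrib)
  then show ?thesis
    by (simp add: poly_mat_def poly_apply_def matrix_vector_mul_assoc[symmetric] mat_mult_vec)
qed

lemma poly_apply_linear_factor:
  fixes M :: "'a::field ^ 'k ^ 'k"
  shows "poly_apply ([:- c, 1:] * q) M v = (M - mat c) *v poly_apply q M v"
proof -
  let ?n = "degree q" and ?a = "\<lambda>l. mat_power M l *v v"
  have Ms: "M *v sum F S = (\<Sum>l\<in>S. M *v F l)" for S and F :: "nat \<Rightarrow> 'a ^ 'k"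
    by (induction S rule: infinite_finite_induct) (simp_all add: matrix_vector_right_distrib)
  have c: "[:- c, 1:] * q = pCons 0 q - smult c q" by simp
  have d: "degree ([:- c, 1:] * q) \<le> Suc ?n"
    by (metis degree_mult_le degree_pCons_eq_if Suc_eq_plus1 add.commute one_neq_zero degree_0 One_nat_def plus_1_eq_Suc pCons_eq_0_iff)
  have "poly_apply ([:- c, 1:] * q) M v
      = (\<Sum>l\<le>Suc ?n. coeff (pCons 0 q) l *s ?a l) - (\<Sum>l\<le>Suc ?n. (c * coeff q l) *s ?a l)"
    unfolding poly_apply_upto[OF d] unfolding c
    by (simp add: vector_sub_rdistrib sum_subtractf vec.scale_left_diff_distrib del: sum.atMost_Suc)
  also have "(\<Sum>l\<le>Suc ?n. coeff (pCons 0 q) l *s ?a l) = M *v poly_apply q M v"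
    by (simp add: sum.atMost_Suc_shift poly_apply_def Ms vector_scalar_commute matrix_vector_mul_assoc
        del: sum.atMost_Suc)
  also have "(\<Sum>l\<le>Suc ?n. (c * coeff q l) *s ?a l) = c *s poly_apply q M v"
    by (simp add: coeff_eq_0 poly_apply_def vec.scale_sum_right)
  finally show ?thesis by (simp add: matrix_vector_mult_diff_rdistrib mat_mult_vec)
qed

text \<open>Some nonzero polynomial annihilates \<open>M\<close>, and over the complex numbers it splits into linear
  factors. Starting from the zero vector, each factor is stripped off by the step above.\<close>

lemma decays_if_eigenvalues_small:
  fixes M :: "complex ^ 'k ^ 'k"
  assumes "\<And>c. eigenvalue M c \<Longrightarrow> cmod c < 1"
  shows "decays M v"
proof -
  have *: "decays M v" if "q \<noteq> 0" "decays M (poly_apply q M v)" for q v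
    using that
  proof (induction "degree q" arbitrary: q)
    case 0
    then obtain a where a: "q = [:a:]" "a \<noteq> 0" by (metis degree_eq_zeroE pCons_0_0)
    have "poly_apply q M v = a *s v" by (simp add: poly_apply_def a)
    then have "decays M (mat (inverse a) *v (a *s v))"
      using 0 decays_commuting[OF _ mat_mult_commute] by simp
    then show ?case using a(2) by (simp add: mat_mult_vec)
  next
    case (Suc n)
    then have "\<not> constant (poly q)" by (metis constant_degree nat.distinct(1))
    then obtain c where "poly q c = 0" using fundamental_theorem_of_algebra by blast
    then obtain r where r: "q = [:- c, 1:] * r" by (metis poly_eq_0_iff_dvd dvdE)
    with Suc.prems have r0: "r \<noteq> 0" by auto
    have "degree q = Suc (degree r)" unfolding r using r0 by (subst degree_mult_eq) auto
    then have "n = degree r" using Suc by simp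
    moreover have "decays M (poly_apply r M v)"
      using Suc.prems(2) unfolding r poly_apply_linear_factor using decays_root_step[OF assms] by blast
    ultimately show ?case using Suc.hyps(1) r0 by blast
  qed
  obtain q where "q \<noteq> 0" "poly_mat q M = 0" using poly_mat_exists by blast
  moreover have "decays M 0" unfolding decays_def by (intro exI[of _ 0] exI[of _ "1/2"]) simp
  ultimately show ?thesis using * by (metis poly_mat_mult_vec matrix_vector_mult_0)
qed

text \<open>The inverse of \<open>A\<close> has spectral radius below \<open>1\<close>, so a large power of it shrinks
  every vector. Over \<open>\<int>\<close> this says that a large power of \<open>A\<close> expands the maximum norm.\<close>

lemma expanding_power:
  fixes A :: "int ^ 'k ^ 'k"
  assumes big: "\<And>c :: complex. eigenvalue (of_int_mat A) c \<Longrightarrow> cmod c > 1"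
  shows "\<exists>s\<ge>d. \<forall>(x :: int ^ 'k) L :: real.
    (\<forall>j. \<bar>real_of_int ((x v* mat_power A s) $ j)\<bar> \<le> L) \<longrightarrow> (\<forall>i. 2 * \<bar>real_of_int (x $ i)\<bar> \<le> L)"
proof -
  let ?A = "of_int_mat A :: complex ^ 'k ^ 'k"
  have "w = 0" if "?A *v w = 0" for w
  proof (rule ccontr)
    assume "w \<noteq> 0"
    then have "eigenvalue ?A 0" using that by (auto simp: eigenvalue_def)
    with big show False by force
  qed
  then obtain M where M: "M ** ?A = mat 1"
    using matrix_left_invertible_ker by blast
  then have AM: "?A ** M = mat 1" using matrix_left_right_inverse by blast
  have "cmod c < 1" if ev: "eigenvalue M c" for c
  proof -
    obtain v where v: "v \<noteq> 0" "M *v v = c *s v" using ev by (auto simp: eigenvalue_def)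
    have "v = ?A *v (M *v v)" by (simp add: matrix_vector_mul_assoc AM)
    then have w: "v = c *s (?A *v v)" by (simp add: v vector_scalar_commute)
    with v(1) have "c \<noteq> 0" by auto
    with w have "?A *v v = inverse c *s v"
      by (metis vec.scale_scale left_inverse vec.scale_one)
    with v have "eigenvalue ?A (inverse c)" by (auto simp: eigenvalue_def)
    then have "1 < inverse (cmod c)" using big[of "inverse c"] by (simp add: norm_inverse)
    then show ?thesis using \<open>c \<noteq> 0\<close> by (simp add: one_less_inverse_iff)
  qed
  then have dec: "decays M v" for v using decays_if_eigenvalues_small by blast
  have tend: "(\<lambda>n. mat_power M n $ i $ j) \<longlonglongrightarrow> 0" for i j
  proof -
    obtain K r where K: "0 < r" "r < 1" "\<And>n. norm (mat_power M n *v axis j 1) \<le> K * r ^ n"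
      using dec[of "axis j 1"] by (auto simp: decays_def)
    have "(\<lambda>n. K * r ^ n) \<longlonglongrightarrow> K * 0"
      using K by (intro tendsto_mult tendsto_const LIMSEQ_power_zero) auto
    moreover have "\<forall>\<^sub>F n in sequentially. cmod (mat_power M n $ i $ j) \<le> K * r ^ n"
    proof (intro always_eventually allI)
      fix n
      have "mat_power M n $ i $ j = (mat_power M n *v axis j 1) $ i"
        by (simp add: matrix_vector_mult_def axis_def if_distrib[of "\<lambda>x. _ * x"] cong: if_cong)
      then show "cmod (mat_power M n $ i $ j) \<le> K * r ^ n"
        using K(3)[of n] by (metis Finite_Cartesian_Product.norm_nth_le order_trans)
    qed
    ultimately show ?thesis using Lim_null_comparison by fastforce
  qed
  define e :: real where "e = 1 / (2 * CARD('k))"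
  have e: "e > 0" by (simp add: e_def)
  have "\<forall>\<^sub>F n in sequentially. \<forall>p\<in>(UNIV :: ('k \<times> 'k) set). cmod (mat_power M n $ fst p $ snd p) < e"
  proof (subst eventually_ball_finite_distrib)
    show "\<forall>p\<in>(UNIV :: ('k \<times> 'k) set).
        \<forall>\<^sub>F n in sequentially. cmod (mat_power M n $ fst p $ snd p) < e"
      using order_tendstoD(2)[OF tendsto_norm_zero[OF tend] e] by blast
  qed simp
  then have "\<forall>\<^sub>F n in sequentially. n \<ge> d \<and> (\<forall>i j. cmod (mat_power M n $ i $ j) < e)"
    using eventually_ge_at_top[of d] by eventually_elim auto
  then obtain s where s: "s \<ge> d" "\<And>i j. cmod (mat_power M s $ i $ j) < e"
    by (metis (lifting) eventually_sequentially order_refl)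
  have "2 * \<bar>real_of_int (x $ i)\<bar> \<le> L"
    if L: "\<And>j. \<bar>real_of_int ((x v* mat_power A s) $ j)\<bar> \<le> L" for x :: "int ^ 'k" and L i
  proof -
    define y where "y = x v* mat_power A s"
    have hom: "(of_int_vec (u v* N) :: complex ^ 'k) = of_int_vec u v* of_int_mat N" for u and N :: "int ^ 'k ^ 'k"
      by (simp add: of_int_vec_def vec_eq_iff vector_matrix_mult_def)
    have pow: "(of_int_mat (mat_power A n) :: complex ^ 'k ^ 'k) = mat_power ?A n" for n
      by (induction n) (simp_all add: vec_eq_iff matrix_matrix_mult_def mat_def)
    have "(of_int_vec x :: complex ^ 'k) = of_int_vec x v* (mat_power ?A s ** mat_power M s)"
      by (simp add: mat_power_inverse[OF AM])
    also have "\<dots> = of_int_vec y v* mat_power M s"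
      by (simp add: y_def hom pow vector_matrix_mul_assoc)
    finally have "complex_of_int (x $ i) = (of_int_vec y v* mat_power M s) $ i"
      by (metis of_int_vec_def vec_lambda_beta)
    also have "\<dots> = (\<Sum>j\<in>UNIV. complex_of_int (y $ j) * mat_power M s $ j $ i)"
      by (simp add: vector_matrix_mult_def of_int_vec_def mult.commute)
    finally have "\<bar>real_of_int (x $ i)\<bar> = cmod (\<Sum>j\<in>UNIV. complex_of_int (y $ j) * mat_power M s $ j $ i)"
      by (metis norm_of_int)
    also have "\<dots> \<le> (\<Sum>j\<in>(UNIV :: 'k set). L * e)"
    proof (rule sum_norm_le)
      fix j
      show "cmod (complex_of_int (y $ j) * mat_power M s $ j $ i) \<le> L * e"
        unfolding norm_mult norm_of_int using L[of j] s(2)[of j i]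
        by (intro mult_mono) (auto simp: y_def)
    qed
    also have "\<dots> = L / 2" by (simp add: e_def)
    finally show ?thesis by simp
  qed
  with s(1) show ?thesis by blast
qed

section \<open>An integral substitute for the inverse\<close>

text \<open>The witness is the adjugate matrix: its entries are determinants of \<open>N\<close> with one row
  replaced by a unit vector, and linearity in that row gives the product.\<close>

lemma ex_adjugate: "\<exists>J. N ** J = mat (det N)" for N :: "'a::comm_ring_1 ^ 'k ^ 'k"
proof -
  define J :: "'a ^ 'k ^ 'k" where
    "J = (\<chi> j k. det (\<chi> i. if i = k then axis j 1 else N $ i))"
  have "(N ** J) $ i $ k = mat (det N) $ i $ k" for i k
  proof -
    let ?R = "\<chi> r. if r = k then N $ i else N $ r"
    have "(N ** J) $ i $ k = (\<Sum>j\<in>UNIV. det (\<chi> r. if r = k then N $ i $ j *s axis j 1 else N $ r))"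
      by (simp add: matrix_matrix_mult_def J_def det_row_mul)
    also have "\<dots> = det (\<chi> r. if r = k then \<Sum>j\<in>UNIV. N $ i $ j *s axis j 1 else N $ r)"
      by (simp add: det_linear_row_sum)
    also have "\<dots> = det ?R" by (simp add: basis_expansion cong: if_cong)
    also have "\<dots> = (if i = k then det N else 0)"
    proof (cases "i = k")
      case True
      then have "?R = N" by (simp add: vec_eq_iff)
      with True show ?thesis by simp
    next
      case False
      then have "det ?R = 0" by (intro det_identical_rows[OF False]) (simp add: row_def)
      with False show ?thesis by simp
    qed
    finally show ?thesis by (simp add: mat_def)
  qed
  then show ?thesis by (intro exI[of _ J]) (simp add: vec_eq_iff)
qed


section \<open>Fourier analysis on vectors modulo \<open>p\<close>\<close>

definition dot :: "int ^ 'k \<Rightarrow> int ^ 'k \<Rightarrow> int" where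
  "dot \<alpha> x = (\<Sum>i\<in>UNIV. \<alpha> $ i * x $ i)"

definition chi :: "nat \<Rightarrow> int \<Rightarrow> complex" where
  "chi p m = cis (2 * pi * (real_of_int m / real p))"

lemma dot_commute: "dot \<alpha> x = dot x \<alpha>"
  by (simp add: dot_def mult.commute)

lemma dot_add_right: "dot \<alpha> (x + y) = dot \<alpha> x + dot \<alpha> y"
  by (simp add: dot_def distrib_left sum.distrib)

lemma dot_add_left: "dot (\<alpha> + \<beta>) x = dot \<alpha> x + dot \<beta> x"
  by (simp add: dot_def distrib_right sum.distrib)

lemma dot_diff_right: "dot \<alpha> (x - y) = dot \<alpha> x - dot \<alpha> y"
  by (simp add: dot_def right_diff_distrib sum_subtractf)

lemma dot_axis: "dot (axis i 1) x = x $ i"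
  by (simp add: dot_def axis_def if_distrib[of "\<lambda>x. x * _"] cong: if_cong)

lemma dot_matrix_mult: "dot \<alpha> (A *v x) = dot (\<alpha> v* A) x"
  unfolding dot_def matrix_vector_mult_def vector_matrix_mult_def vec_lambda_beta
    sum_distrib_left sum_distrib_right
  by (subst sum.swap) (simp add: mult_ac)

lemma norm_chi [simp]: "norm (chi p m) = 1"
  by (simp add: chi_def)

lemma chi_0 [simp]: "chi p 0 = 1"
  by (simp add: chi_def)

lemma chi_add: "chi p (m + n) = chi p m * chi p n"
  by (simp add: chi_def cis_mult add_divide_distrib distrib_left)

lemma cnj_chi: "cnj (chi p m) = chi p (- m)"
  by (simp add: chi_def cis_cnj)

lemma chi_multiple: "p > 0 \<Longrightarrow> chi p (int p * m) = 1"
  unfolding chi_def by (simp add: cis_multiple_2pi)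

lemma chi_cong:
  assumes "p > 0" "m mod int p = n mod int p"
  shows "chi p m = chi p n"
proof -
  obtain q where "m = n + int p * q"
    using assms(2) by (metis mod_eqE add.commute)
  then show ?thesis using assms(1) by (simp add: chi_add chi_multiple)
qed

lemma chi_eq_1_iff:
  assumes "p > 0"
  shows "chi p m = 1 \<longleftrightarrow> int p dvd m"
proof
  assume "chi p m = 1"
  then have "cos (2 * pi * (real_of_int m / real p)) = 1"
    by (simp add: chi_def complex_eq_iff)
  then obtain q :: int where "2 * pi * (real_of_int m / real p) = of_int q * 2 * pi"
    using cos_one_2pi_int by auto
  then have "real_of_int m = real_of_int (int p * q)"
    using assms by (simp add: field_simps)
  then show "int p dvd m" by (metis of_int_eq_iff dvd_triv_left)
qed (use assms in \<open>auto simp: chi_multiple\<close>)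

lemma dot_vec_mod_right: "dot \<alpha> (vec_mod x p) mod int p = dot \<alpha> x mod int p"
  unfolding dot_def vec_mod_def vec_lambda_beta
  by (subst (1 2) mod_sum_eq[symmetric]) (simp add: mod_mult_right_eq)

lemma dot_vec_mod_left: "dot (vec_mod \<alpha> p) x mod int p = dot \<alpha> x mod int p"
  by (simp add: dot_commute[of _ x] dot_vec_mod_right)

lemma vec_mod_in_residue_vectors: "p > 0 \<Longrightarrow> vec_mod x p \<in> residue_vectors p"
  by (simp add: vec_mod_def residue_vectors_def)

lemma vec_mod_eqI:
  "x \<in> residue_vectors p \<Longrightarrow> y \<in> residue_vectors p \<Longrightarrow> vec_mod x p = vec_mod y p \<Longrightarrow> x = y"
  by (auto simp: residue_vectors_def vec_mod_def vec_eq_iff)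

lemma finite_residue_vectors [simp]: "finite (residue_vectors p :: (int ^ 'k) set)"
proof (rule finite_subset)
  show "(residue_vectors p :: (int ^ 'k) set) \<subseteq> vec_lambda ` (UNIV \<rightarrow>\<^sub>E {0..<int p})"
  proof
    fix x :: "int ^ 'k"
    assume "x \<in> residue_vectors p"
    then have "vec_nth x \<in> UNIV \<rightarrow>\<^sub>E {0..<int p}" by (auto simp: residue_vectors_def)
    then show "x \<in> vec_lambda ` (UNIV \<rightarrow>\<^sub>E {0..<int p})"
      by (metis image_eqI vec_nth_inverse)
  qed
qed (simp add: finite_PiE)

lemma zero_in_residue_vectors: "p > 0 \<Longrightarrow> 0 \<in> residue_vectors p"
  by (simp add: residue_vectors_def)

text \<open>Shifting a summation variable by a unit vector multiplies the sum by a value of \<open>chi\<close>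
  that differs from \<open>1\<close>, so the sum vanishes.\<close>

lemma sum_chi_eq_0:
  fixes z :: "int ^ 'k"
  assumes p: "p > 0" and z: "\<not> int p dvd z $ i"
  shows "(\<Sum>\<alpha>\<in>residue_vectors p. chi p (dot \<alpha> z)) = 0"
proof -
  let ?R = "residue_vectors p :: (int ^ 'k) set" and ?s = "\<lambda>\<alpha>. vec_mod (\<alpha> + axis i 1) p"
  have inj: "inj_on ?s ?R"
  proof (rule inj_onI)
    fix x y :: "int ^ 'k"
    assume xy: "x \<in> ?R" "y \<in> ?R" and eq: "?s x = ?s y"
    have "x $ j mod int p = y $ j mod int p" for j
    proof -
      have "(x $ j + axis i 1 $ j) mod int p = (y $ j + axis i 1 $ j) mod int p"
        using eq by (simp add: vec_mod_def vec_eq_iff)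
      then show ?thesis by (simp add: mod_eq_dvd_iff)
    qed
    then have "vec_mod x p = vec_mod y p" by (simp add: vec_mod_def)
    with xy show "x = y" by (blast intro: vec_mod_eqI)
  qed
  moreover have "?s ` ?R \<subseteq> ?R" using p by (auto intro: vec_mod_in_residue_vectors)
  ultimately have bij: "bij_betw ?s ?R ?R"
    by (simp add: bij_betw_def endo_inj_surj)
  have "(\<Sum>\<alpha>\<in>?R. chi p (dot \<alpha> z)) = (\<Sum>\<alpha>\<in>?R. chi p (dot (?s \<alpha>) z))"
    by (rule sum.reindex_bij_betw[OF bij, symmetric])
  also have "\<dots> = (\<Sum>\<alpha>\<in>?R. chi p (dot \<alpha> z) * chi p (z $ i))"
  proof (rule sum.cong)
    fix \<alpha>
    have "chi p (dot (?s \<alpha>) z) = chi p (dot (\<alpha> + axis i 1) z)"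
      using dot_vec_mod_left by (rule chi_cong[OF p])
    then show "chi p (dot (?s \<alpha>) z) = chi p (dot \<alpha> z) * chi p (z $ i)"
      by (simp add: dot_add_left dot_axis chi_add)
  qed simp
  finally have "(\<Sum>\<alpha>\<in>?R. chi p (dot \<alpha> z)) = (\<Sum>\<alpha>\<in>?R. chi p (dot \<alpha> z)) * chi p (z $ i)"
    unfolding sum_distrib_right .
  then show ?thesis using chi_eq_1_iff[OF p] z by auto
qed

lemma sum_chi_difference:
  fixes x y :: "int ^ 'k"
  assumes p: "p > 0" and x: "x \<in> residue_vectors p" and y: "y \<in> residue_vectors p"
  shows "(\<Sum>\<alpha>\<in>residue_vectors p. chi p (dot \<alpha> (x - y)))
       = (if x = y then of_nat (card (residue_vectors p :: (int ^ 'k) set)) else 0)"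
proof (cases "x = y")
  case True
  then show ?thesis by (simp add: dot_def)
next
  case False
  then obtain i where "x $ i \<noteq> y $ i" by (auto simp: vec_eq_iff)
  then have "x $ i mod int p \<noteq> y $ i mod int p" using x y by (auto simp: residue_vectors_def)
  then have "\<not> int p dvd (x - y) $ i" by (simp add: mod_eq_dvd_iff)
  then show ?thesis using False sum_chi_eq_0[OF p, of "x - y" i] by simp
qed

lemma plancherel:
  fixes h :: "int ^ 'k \<Rightarrow> real"
  assumes p: "p > 0"
  defines "R \<equiv> residue_vectors p :: (int ^ 'k) set"
  shows "(\<Sum>\<alpha>\<in>R. (cmod (\<Sum>x\<in>R. h x * chi p (dot \<alpha> x)))\<^sup>2) = card R * (\<Sum>x\<in>R. (h x)\<^sup>2)"
proof -
  have "complex_of_real (\<Sum>\<alpha>\<in>R. (cmod (\<Sum>x\<in>R. h x * chi p (dot \<alpha> x)))\<^sup>2)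
      = (\<Sum>\<alpha>\<in>R. (\<Sum>x\<in>R. h x * chi p (dot \<alpha> x)) * cnj (\<Sum>y\<in>R. h y * chi p (dot \<alpha> y)))"
    unfolding of_real_sum complex_norm_square ..
  also have "\<dots> = (\<Sum>\<alpha>\<in>R. \<Sum>x\<in>R. \<Sum>y\<in>R. complex_of_real (h x * h y) * chi p (dot \<alpha> (x - y)))"
    by (simp add: sum_product cnj_chi dot_diff_right chi_add[of _ _ "- _", simplified] mult_ac)
  also have "\<dots> = (\<Sum>x\<in>R. \<Sum>y\<in>R. complex_of_real (h x * h y) * (\<Sum>\<alpha>\<in>R. chi p (dot \<alpha> (x - y))))"
    unfolding sum_distrib_left by (subst sum.swap) (intro sum.cong refl sum.swap)
  also have "\<dots> = (\<Sum>x\<in>R. \<Sum>y\<in>R. if x = y then complex_of_real (h x * h x) * card R else 0)"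
    unfolding R_def by (intro sum.cong refl, subst sum_chi_difference[OF p]) simp_all
  also have "\<dots> = (\<Sum>x\<in>R. complex_of_real (card R * (h x)\<^sup>2))"
    by (intro sum.cong refl) (simp add: R_def power2_eq_square)
  also have "\<dots> = complex_of_real (card R * (\<Sum>x\<in>R. (h x)\<^sup>2))"
    unfolding sum_distrib_left of_real_sum ..
  finally show ?thesis unfolding of_real_eq_iff .
qed

text \<open>Cauchy--Schwarz bounds the \<open>L\<^sup>1\<close> distance by the \<open>L\<^sup>2\<close> distance, which Plancherel
  computes; the frequency \<open>0\<close> drops out because both laws have total mass \<open>1\<close>.\<close>

lemma variation_distance_upper_bound:
  fixes P :: "int ^ 'k \<Rightarrow> real"
  assumes p: "p > 0"
  defines "R \<equiv> residue_vectors p :: (int ^ 'k) set"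
  assumes mass: "sum P R = 1"
  shows "4 * (variation_distance p P (uniform_law p))\<^sup>2
    \<le> (\<Sum>\<alpha>\<in>R - {0}. (cmod (\<Sum>x\<in>R. P x * chi p (dot \<alpha> x)))\<^sup>2)"
proof -
  let ?U = "uniform_law p :: int ^ 'k \<Rightarrow> real"
  define h where "h x = P x - ?U x" for x
  have fR: "finite R" "R \<noteq> {}" "0 \<in> R"
    using zero_in_residue_vectors[OF p] by (auto simp: R_def)
  have U: "?U x = 1 / card R" if "x \<in> R" for x
    using fR that by (simp add: uniform_law_def R_def pmf_of_set)
  have hat: "(\<Sum>x\<in>R. h x * chi p (dot \<alpha> x)) = (if \<alpha> = 0 then 0 else \<Sum>x\<in>R. P x * chi p (dot \<alpha> x))"
    if "\<alpha> \<in> R" for \<alpha>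
  proof -
    have "(\<Sum>x\<in>R. chi p (dot \<alpha> x)) = (\<Sum>x\<in>R. chi p (dot x (\<alpha> - 0)))"
      by (simp add: dot_commute)
    also have "\<dots> = (if \<alpha> = 0 then of_nat (card R) else 0)"
      unfolding R_def by (rule sum_chi_difference[OF p]) (use that fR in \<open>auto simp: R_def\<close>)
    finally have S: "(\<Sum>x\<in>R. chi p (dot \<alpha> x)) = (if \<alpha> = 0 then of_nat (card R) else 0)" .
    have "(\<Sum>x\<in>R. h x * chi p (dot \<alpha> x))
        = (\<Sum>x\<in>R. P x * chi p (dot \<alpha> x)) - (\<Sum>x\<in>R. 1 / card R * chi p (dot \<alpha> x))"
      by (simp add: h_def U left_diff_distrib sum_subtractf)
    also have "(\<Sum>x\<in>R. 1 / card R * chi p (dot \<alpha> x)) = (if \<alpha> = 0 then 1 else 0)"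
      unfolding sum_distrib_left[symmetric] S using fR by simp
    also have "(\<Sum>x\<in>R. P x * chi p (dot \<alpha> x)) - (if \<alpha> = 0 then 1 else 0)
        = (if \<alpha> = 0 then 0 else \<Sum>x\<in>R. P x * chi p (dot \<alpha> x))"
      using mass by (auto simp: dot_def simp flip: of_real_sum)
    finally show ?thesis .
  qed
  have "4 * (variation_distance p P ?U)\<^sup>2 = (\<Sum>x\<in>R. \<bar>h x\<bar>)\<^sup>2"
    by (simp add: variation_distance_def h_def R_def power_divide)
  also have "\<dots> \<le> card R * (\<Sum>x\<in>R. (h x)\<^sup>2)"
    using sum_squared_le_sum_of_squares[of "\<lambda>x. \<bar>h x\<bar>" R] by (simp add: mult.commute)
  also have "\<dots> = (\<Sum>\<alpha>\<in>R. (cmod (\<Sum>x\<in>R. h x * chi p (dot \<alpha> x)))\<^sup>2)"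
    unfolding R_def by (rule plancherel[OF p, symmetric])
  also have "\<dots> = (\<Sum>\<alpha>\<in>R - {0}. (cmod (\<Sum>x\<in>R. P x * chi p (dot \<alpha> x)))\<^sup>2)"
    using fR by (subst sum.remove[of R 0]) (auto simp: hat intro: sum.cong)
  finally show ?thesis .
qed

section \<open>The characteristic function of the walk\<close>

definition char_pmf :: "nat \<Rightarrow> (int ^ 'k) pmf \<Rightarrow> int ^ 'k \<Rightarrow> complex" where
  "char_pmf p \<mu> \<alpha> = measure_pmf.expectation \<mu> (\<lambda>x. chi p (dot \<alpha> x))"

lemma norm_char_pmf_le_1: "cmod (char_pmf p \<mu> \<alpha>) \<le> 1"
proof -
  have "cmod (char_pmf p \<mu> \<alpha>) \<le> measure_pmf.expectation \<mu> (\<lambda>x. norm (chi p (dot \<alpha> x)))"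
    unfolding char_pmf_def by (rule integral_norm_bound)
  then show ?thesis by simp
qed

lemma char_pmf_cong:
  assumes "p > 0" "vec_mod \<alpha> p = vec_mod \<beta> p"
  shows "char_pmf p \<mu> \<alpha> = char_pmf p \<mu> \<beta>"
proof -
  have "chi p (dot \<alpha> x) = chi p (dot \<beta> x)" for x
    by (rule chi_cong[OF assms(1)])
      (use dot_vec_mod_left[of \<alpha> p x] dot_vec_mod_left[of \<beta> p x] assms(2) in simp)
  then show ?thesis by (simp add: char_pmf_def)
qed

text \<open>To separate the first \<open>n\<close> increments from the next one, the walk is regarded as a function
  on the product space of these increments: the coordinate projections play the role of \<open>b\<close>.\<close>

lemma measurable_walk:
  "(\<lambda>f. walk A (\<lambda>i f. f i) x0 p n f) \<in> PiM {..<n} (\<lambda>_. count_space UNIV) \<rightarrow>\<^sub>M count_space UNIV"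
proof -
  have "(\<lambda>f. walk A (\<lambda>i f. f i) x0 p m f) \<in> PiM {..<n} (\<lambda>_. count_space UNIV) \<rightarrow>\<^sub>M count_space UNIV"
    if "m \<le> n" for m
    using that
  proof (induction m)
    case (Suc m)
    let ?N = "PiM {..<n} (\<lambda>_. count_space UNIV) :: (nat \<Rightarrow> int ^ 'a) measure"
    have 1: "(\<lambda>f. walk A (\<lambda>i f. f i) x0 p m f) \<in> ?N \<rightarrow>\<^sub>M count_space UNIV" using Suc by simp
    have 2: "(\<lambda>f. f m) \<in> ?N \<rightarrow>\<^sub>M count_space UNIV"
      using Suc.prems by (intro measurable_component_singleton) auto
    have "(\<lambda>f. vec_mod (A *v x + f m) p) \<in> ?N \<rightarrow>\<^sub>M count_space UNIV" for x
      by (rule measurable_compose[OF 2]) simp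
    from measurable_compose_countable[OF this 1] show ?case by simp
  next
    case 0
    show ?case unfolding walk.simps by (rule measurable_const) simp
  qed
  then show ?thesis by simp
qed

lemma walk_restrict: "walk A b x0 p n \<omega> = walk A (\<lambda>i f. f i) x0 p n (\<lambda>i\<in>{..<n}. b i \<omega>)"
proof -
  have "walk A b x0 p m \<omega> = walk A (\<lambda>i f. f i) x0 p m (\<lambda>i\<in>{..<n}. b i \<omega>)" if "m \<le> n" for m
    using that by (induction m) auto
  then show ?thesis by simp
qed

lemma walk_in_residue_vectors: "p > 0 \<Longrightarrow> walk A b x0 p n \<omega> \<in> residue_vectors p"
  by (cases n) (simp_all add: vec_mod_in_residue_vectors)

context prob_space
begin

lemma walk_step_indep:
  assumes "indep_vars (\<lambda>_. count_space UNIV) b UNIV"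
  shows "indep_var (count_space UNIV) (walk A b x0 p n) (count_space UNIV) (b n)"
proof -
  let ?C = "\<lambda>_ :: nat. count_space (UNIV :: (int ^ 'b) set)"
  have "indep_var (PiM {..<n} ?C) (\<lambda>\<omega>. \<lambda>i\<in>{..<n}. b i \<omega>) (PiM {n} ?C) (\<lambda>\<omega>. \<lambda>i\<in>{n}. b i \<omega>)"
    by (rule indep_var_restrict[OF assms]) auto
  from indep_var_compose[OF this measurable_walk[of A x0 p n] measurable_component_singleton[of n]]
  have "indep_var (count_space UNIV) ((\<lambda>f. walk A (\<lambda>i f. f i) x0 p n f) \<circ> (\<lambda>\<omega>. \<lambda>i\<in>{..<n}. b i \<omega>))
    (count_space UNIV) ((\<lambda>f. f n) \<circ> (\<lambda>\<omega>. \<lambda>i\<in>{n}. b i \<omega>))" by simp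
  moreover have "(\<lambda>f. walk A (\<lambda>i f. f i) x0 p n f) \<circ> (\<lambda>\<omega>. \<lambda>i\<in>{..<n}. b i \<omega>) = walk A b x0 p n"
    by (auto simp: walk_restrict[of A b])
  moreover have "(\<lambda>f. f n) \<circ> (\<lambda>\<omega>. \<lambda>i\<in>{n}. b i \<omega>) = b n" by auto
  ultimately show ?thesis by simp
qed

text \<open>From \<open>\<alpha> \<bullet> (A x + b) = (\<alpha> A) \<bullet> x + \<alpha> \<bullet> b\<close> and independence, one step of the walk multiplies the
  transform by \<open>char_pmf\<close> at \<open>\<alpha>\<close> and moves the frequency to \<open>\<alpha> A\<close>.\<close>

lemma expectation_chi_walk:
  assumes p: "p > 0"
    and indep: "indep_vars (\<lambda>_. count_space UNIV) b UNIV"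
    and law: "\<And>n. distr M (count_space UNIV) (b n) = measure_pmf \<mu>"
  shows "(cmod (expectation (\<lambda>\<omega>. chi p (dot \<alpha> (walk A b x0 p n \<omega>)))))\<^sup>2
    = (\<Prod>j<n. (cmod (char_pmf p \<mu> (\<alpha> v* mat_power A j)))\<^sup>2)"
proof (induction n arbitrary: \<alpha>)
  case 0
  then show ?case by (simp add: prob_space)
next
  case (Suc n)
  have iv: "indep_var (count_space UNIV) (walk A b x0 p n) (count_space UNIV) (b n)"
    by (rule walk_step_indep[OF indep])
  let ?g = "\<lambda>\<alpha> x. chi p (dot \<alpha> x)"
  have bc: "indep_var borel (?g (\<alpha> v* A) \<circ> walk A b x0 p n) borel (?g \<alpha> \<circ> b n)"
    by (rule indep_var_compose[OF iv]) simp_all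
  have rv: "walk A b x0 p n \<in> M \<rightarrow>\<^sub>M count_space UNIV" "b n \<in> M \<rightarrow>\<^sub>M count_space UNIV"
    using iv by (auto dest: indep_var_rv1 indep_var_rv2)
  have int: "integrable M (?g \<beta> \<circ> X)" if X: "X \<in> M \<rightarrow>\<^sub>M count_space UNIV" for \<beta> X
  proof (rule integrable_const_bound[of _ 1])
    show "?g \<beta> \<circ> X \<in> borel_measurable M" by (rule measurable_comp[OF X]) simp
  qed simp
  have "?g \<alpha> (walk A b x0 p (Suc n) \<omega>) = (?g (\<alpha> v* A) \<circ> walk A b x0 p n) \<omega> * (?g \<alpha> \<circ> b n) \<omega>" for \<omega>
  proof -
    have "?g \<alpha> (walk A b x0 p (Suc n) \<omega>) = chi p (dot \<alpha> (A *v walk A b x0 p n \<omega> + b n \<omega>))"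
      using dot_vec_mod_right by (auto intro: chi_cong[OF p])
    then show ?thesis by (simp add: dot_add_right chi_add dot_matrix_mult)
  qed
  then have "expectation (\<lambda>\<omega>. ?g \<alpha> (walk A b x0 p (Suc n) \<omega>))
      = expectation (?g (\<alpha> v* A) \<circ> walk A b x0 p n) * expectation (?g \<alpha> \<circ> b n)"
    using indep_var_lebesgue_integral[OF bc int[OF rv(1)] int[OF rv(2)]] by (simp only:)
  also have "expectation (?g \<alpha> \<circ> b n) = char_pmf p \<mu> \<alpha>"
    unfolding char_pmf_def law[of n, symmetric] using rv
    by (subst integral_distr) (auto simp: comp_def)
  finally have "(cmod (expectation (\<lambda>\<omega>. ?g \<alpha> (walk A b x0 p (Suc n) \<omega>))))\<^sup>2
      = (\<Prod>j<n. (cmod (char_pmf p \<mu> ((\<alpha> v* A) v* mat_power A j)))\<^sup>2) * (cmod (char_pmf p \<mu> \<alpha>))\<^sup>2"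
    using Suc[of "\<alpha> v* A"] by (simp add: norm_mult power_mult_distrib comp_def)
  then show ?case
    by (subst prod.lessThan_Suc_shift) (simp add: vector_matrix_mul_assoc mult.commute)
qed

lemma sum_walk_law:
  fixes g :: "int ^ 'k \<Rightarrow> 'c::{banach, second_countable_topology}"
  assumes p: "p > 0"
    and rv: "walk A b x0 p n \<in> M \<rightarrow>\<^sub>M count_space UNIV"
  shows "(\<Sum>x\<in>residue_vectors p. walk_law M A b x0 p n x *\<^sub>R g x)
    = expectation (\<lambda>\<omega>. g (walk A b x0 p n \<omega>))"
proof -
  let ?X = "walk A b x0 p n" and ?R = "residue_vectors p :: (int ^ 'k) set"
  have ev: "?X -` {x} \<inter> space M \<in> events" for x
    using rv by (rule measurable_sets) simp
  have "expectation (\<lambda>\<omega>. g (?X \<omega>))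
      = expectation (\<lambda>\<omega>. \<Sum>x\<in>?R. indicat_real (?X -` {x} \<inter> space M) \<omega> *\<^sub>R g x)"
  proof (rule Bochner_Integration.integral_cong[OF refl])
    fix \<omega> assume w: "\<omega> \<in> space M"
    have "(\<Sum>x\<in>?R. indicat_real (?X -` {x} \<inter> space M) \<omega> *\<^sub>R g x) = (\<Sum>x\<in>?R. if x = ?X \<omega> then g x else 0)"
      using w by (intro sum.cong) (auto simp: indicator_def)
    then show "g (?X \<omega>) = (\<Sum>x\<in>?R. indicat_real (?X -` {x} \<inter> space M) \<omega> *\<^sub>R g x)"
      using walk_in_residue_vectors[OF p, of A b x0 n \<omega>] by simp
  qed
  also have "\<dots> = (\<Sum>x\<in>?R. prob (?X -` {x} \<inter> space M) *\<^sub>R g x)"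
    using ev by (subst Bochner_Integration.integral_sum) (auto simp: integrable_real_indicator emeasure_eq_measure)
  also have "\<dots> = (\<Sum>x\<in>?R. walk_law M A b x0 p n x *\<^sub>R g x)"
    using rv by (simp add: walk_law_def measure_distr)
  finally show ?thesis by simp
qed

lemma variation_distance_walk_bound:
  fixes b :: "nat \<Rightarrow> 'a \<Rightarrow> int ^ 'k"
  assumes p: "p > 0"
    and indep: "indep_vars (\<lambda>_. count_space UNIV) b UNIV"
    and law: "\<And>n. distr M (count_space UNIV) (b n) = measure_pmf \<mu>"
  shows "4 * (variation_distance p (walk_law M A b x0 p n) (uniform_law p))\<^sup>2
    \<le> (\<Sum>\<alpha>\<in>residue_vectors p - {0}. \<Prod>j<n. (cmod (char_pmf p \<mu> (\<alpha> v* mat_power A j)))\<^sup>2)"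
proof -
  have rv: "walk A b x0 p n \<in> M \<rightarrow>\<^sub>M count_space UNIV"
    using walk_step_indep[OF indep] by (rule indep_var_rv1)
  have "sum (walk_law M A b x0 p n) (residue_vectors p) = 1"
    using sum_walk_law[OF p rv, of "\<lambda>_. 1 :: real"] by (simp add: prob_space)
  from variation_distance_upper_bound[OF p this] show ?thesis
    using sum_walk_law[OF p rv, of "\<lambda>x. chi p (dot _ x)"]
    by (simp add: expectation_chi_walk[OF p indep law] scaleR_conv_of_real)
qed

end


section \<open>Cutting time into blocks\<close>

lemma prod_lessThan_add:
  "(\<Prod>j<m + n. g j) = (\<Prod>j<m. g j) * (\<Prod>j<n. g (m + j) :: 'a::comm_monoid_mult)" for m n :: nat
  by (induction n) (simp_all add: mult_ac)

lemma prod_lessThan_mult: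
  "(\<Prod>j<q * r. g j) = (\<Prod>i<r. \<Prod>j<q. g (q * i + j) :: 'a::comm_monoid_mult)" for q r :: nat
  by (induction r) (simp_all add: prod_lessThan_add add.commute[of q])

lemma prod_le_mean_power:
  fixes y :: "nat \<Rightarrow> real"
  assumes "r > 0" "\<And>i. i < r \<Longrightarrow> 0 \<le> y i"
  shows "(\<Prod>i<r. y i) \<le> (\<Sum>i<r. y i ^ r) / r"
proof -
  have root: "(P ^ r) powr (1 / real r) = P" if "0 < P \<or> P = 0" for P :: real
    using that assms(1) by (auto simp: powr_realpow[symmetric] powr_powr)
  have P: "0 \<le> (\<Prod>i<r. y i)" using assms by (auto intro: prod_nonneg)
  have "(\<Prod>i<r. y i ^ r) powr (1 / card {..<r}) \<le> (\<Sum>i<r. y i ^ r / card {..<r})"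
    using assms by (intro arith_geom_mean) auto
  also have "(\<Prod>i<r. y i ^ r) powr (1 / card {..<r}) = (\<Prod>i<r. y i)"
    unfolding prod_power_distrib[symmetric] using root P by (simp add: less_eq_real_def)
  finally show ?thesis by (simp add: sum_divide_distrib)
qed

lemma vec_mod_eq_iff: "vec_mod x p = vec_mod y p \<longleftrightarrow> (\<forall>i. int p dvd x $ i - y $ i)"
  by (simp add: vec_mod_def vec_eq_iff mod_eq_dvd_iff)

lemma vec_mod_mult_cong:
  assumes "vec_mod x p = vec_mod y p"
  shows "vec_mod (x v* N) p = vec_mod (y v* N) p"
proof -
  have "int p dvd (\<Sum>j\<in>UNIV. (x $ j - y $ j) * N $ j $ i)" for i
    using assms by (intro dvd_sum) (simp add: vec_mod_eq_iff)
  moreover have "(\<Sum>j\<in>UNIV. (x $ j - y $ j) * N $ j $ i) = (x v* N) $ i - (y v* N) $ i" for i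
    by (simp add: vector_matrix_mult_def left_diff_distrib sum_subtractf)
  ultimately show ?thesis by (simp add: vec_mod_eq_iff)
qed

lemma vec_mod_vec_mod: "vec_mod (vec_mod x p) p = vec_mod x p"
  by (simp add: vec_mod_def)

lemma vector_matrix_mult_mat: "x v* mat c = c *s (x :: 'a::comm_ring_1 ^ 'k)"
  by (simp add: vector_matrix_mult_def mat_def vec_eq_iff if_distrib[of "\<lambda>x. x * _"]
      if_distrib[of "\<lambda>x. _ * x"] mult.commute cong: if_cong)

lemma vec_mod_mult_cancel:
  assumes "coprime (det N) (int p)" "vec_mod (x v* N) p = vec_mod (y v* N) p"
  shows "vec_mod x p = vec_mod y p"
proof -
  obtain J where J: "N ** J = mat (det N)" using ex_adjugate by blast
  have "vec_mod (det N *s x) p = vec_mod (det N *s y) p"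
    using vec_mod_mult_cong[OF assms(2), of J]
    by (simp add: vector_matrix_mul_assoc J vector_matrix_mult_mat)
  then have "int p dvd det N * (x $ i - y $ i)" for i
    by (simp add: vec_mod_eq_iff right_diff_distrib)
  then show ?thesis
    using assms(1) by (simp add: vec_mod_eq_iff coprime_commute coprime_dvd_mult_right_iff)
qed

lemma det_mat_power: "det (mat_power A n) = det A ^ n"
  by (induction n) (simp_all add: det_mul)

lemma bij_betw_mult_residues:
  fixes N :: "int ^ 'k ^ 'k"
  assumes p: "p > 0" and N: "coprime (det N) (int p)"
  shows "bij_betw (\<lambda>\<alpha>. vec_mod (\<alpha> v* N) p) (residue_vectors p - {0}) (residue_vectors p - {0})"
proof -
  let ?R = "residue_vectors p :: (int ^ 'k) set"
  have inj: "inj_on (\<lambda>\<alpha>. vec_mod (\<alpha> v* N) p) ?R"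
    using vec_mod_eqI vec_mod_mult_cancel[OF N] by (blast intro: inj_onI)
  moreover have "(\<lambda>\<alpha>. vec_mod (\<alpha> v* N) p) ` (?R - {0}) \<subseteq> ?R - {0}"
  proof -
    have "vec_mod (0 v* N) p = 0" by (simp add: vec_mod_def vec_eq_iff)
    then show ?thesis
      using inj_onD[OF inj, of _ 0] zero_in_residue_vectors[OF p] vec_mod_in_residue_vectors[OF p]
      by auto
  qed
  ultimately show ?thesis
    by (simp add: bij_betw_def endo_inj_surj inj_on_diff)
qed

text \<open>The arithmetic-geometric mean inequality replaces a product over \<open>r\<close> blocks by the mean
  of the \<open>r\<close>-th powers of the single blocks. All blocks contribute the same after summation,
  because multiplication by a power of \<open>A\<close> permutes the nonzero frequencies.\<close>

lemma sum_prod_le_sum_block_power: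
  fixes f :: "int ^ 'k \<Rightarrow> real"
  assumes p: "p > 0" and A: "coprime (det A) (int p)"
    and f01: "\<And>\<alpha>. 0 \<le> f \<alpha>" "\<And>\<alpha>. f \<alpha> \<le> 1"
    and fcong: "\<And>\<alpha> \<beta>. vec_mod \<alpha> p = vec_mod \<beta> p \<Longrightarrow> f \<alpha> = f \<beta>"
    and n: "q * r \<le> n"
  shows "(\<Sum>\<alpha>\<in>residue_vectors p - {0}. \<Prod>j<n. f (\<alpha> v* mat_power A j))
    \<le> (\<Sum>\<alpha>\<in>residue_vectors p - {0}. (\<Prod>j<q. f (\<alpha> v* mat_power A j)) ^ r)"
proof -
  let ?R = "residue_vectors p - {0} :: (int ^ 'k) set"
  define F where "F \<alpha> = (\<Prod>j<q. f (\<alpha> v* mat_power A j))" for \<alpha>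
  have F0: "0 \<le> F \<alpha>" for \<alpha> by (auto simp: F_def intro: prod_nonneg f01)
  have Fcong: "F \<alpha> = F \<beta>" if "vec_mod \<alpha> p = vec_mod \<beta> p" for \<alpha> \<beta>
    using fcong[OF vec_mod_mult_cong[OF that]] by (simp add: F_def)
  have le: "(\<Prod>j<n. f (\<alpha> v* mat_power A j)) \<le> (\<Prod>i<r. F (\<alpha> v* mat_power A (q * i)))" for \<alpha>
  proof -
    obtain n' where n': "n = q * r + n'" using n le_Suc_ex by blast
    have "(\<Prod>j<n. f (\<alpha> v* mat_power A j)) \<le> (\<Prod>j<q * r. f (\<alpha> v* mat_power A j)) * 1"
      unfolding n' prod_lessThan_add
      by (intro mult_left_mono prod_le_1 prod_nonneg) (auto simp: f01)
    then show ?thesis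
      by (simp add: prod_lessThan_mult F_def vector_matrix_mul_assoc mat_power_add)
  qed
  have shift: "(\<Sum>\<alpha>\<in>?R. F (\<alpha> v* mat_power A m) ^ r) = (\<Sum>\<alpha>\<in>?R. F \<alpha> ^ r)" for m
  proof -
    have "coprime (det (mat_power A m)) (int p)" using A by (simp add: det_mat_power)
    from sum.reindex_bij_betw[OF bij_betw_mult_residues[OF p this], of "\<lambda>\<alpha>. F \<alpha> ^ r"]
    show ?thesis using Fcong[OF vec_mod_vec_mod] by simp
  qed
  have "(\<Sum>\<alpha>\<in>?R. \<Prod>i<r. F (\<alpha> v* mat_power A (q * i))) \<le> (\<Sum>\<alpha>\<in>?R. F \<alpha> ^ r)"
  proof (cases "r = 0")
    case False
    have "(\<Sum>\<alpha>\<in>?R. \<Prod>i<r. F (\<alpha> v* mat_power A (q * i)))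
        \<le> (\<Sum>\<alpha>\<in>?R. (\<Sum>i<r. F (\<alpha> v* mat_power A (q * i)) ^ r) / r)"
      using False F0 by (intro sum_mono prod_le_mean_power) auto
    also have "\<dots> = (\<Sum>i<r. \<Sum>\<alpha>\<in>?R. F (\<alpha> v* mat_power A (q * i)) ^ r) / r"
      unfolding sum_divide_distrib[symmetric] by (subst sum.swap) simp
    also have "\<dots> = (\<Sum>\<alpha>\<in>?R. F \<alpha> ^ r)" using False by (simp add: shift)
    finally show ?thesis .
  qed simp
  with sum_mono[of ?R "\<lambda>\<alpha>. \<Prod>j<n. f (\<alpha> v* mat_power A j)", OF le]
  show ?thesis unfolding F_def by (rule order_trans)
qed

section \<open>Symmetric residues and digits\<close>

text \<open>The representative of \<open>x\<close> modulo \<open>p\<close> in the interval from \<open>- p / 2\<close> to \<open>p / 2\<close>, hence one of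
  least absolute value.\<close>

definition sres :: "nat \<Rightarrow> int \<Rightarrow> int" where
  "sres p x = (x + int p div 2) mod int p - int p div 2"

lemma abs_sres_le:
  assumes "p > 0"
  shows "2 * \<bar>sres p x\<bar> \<le> int p"
proof -
  define r where "r = (x + int p div 2) mod int p"
  have "0 \<le> r" "r < int p" using assms by (simp_all add: r_def)
  then show ?thesis unfolding sres_def r_def[symmetric] by presburger
qed

lemma dvd_diff_sres: "int p dvd x - sres p x"
proof -
  have "x - sres p x = (x + int p div 2) - (x + int p div 2) mod int p"
    by (simp add: sres_def)
  then show ?thesis by (simp only: dvd_minus_mod)
qed

lemma abs_sres_min:
  assumes "p > 0" "int p dvd x - y"
  shows "\<bar>sres p x\<bar> \<le> \<bar>y\<bar>"
proof (rule ccontr)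
  assume *: "\<not> ?thesis"
  have d: "int p dvd sres p x - y"
    using dvd_diff[OF assms(2) dvd_diff_sres[of p x]] by simp
  have "\<bar>sres p x - y\<bar> < int p" using * abs_sres_le[OF assms(1), of x] by linarith
  with d have "sres p x - y = 0"
    by (metis abs_ge_zero abs_of_nat dvd_imp_le_int linorder_not_less)
  with * show False by simp
qed

lemma chi_sres: "p > 0 \<Longrightarrow> chi p (sres p x) = chi p x"
  using dvd_diff_sres[of p x] by (intro chi_cong) (simp_all add: mod_eq_dvd_iff dvd_diff_commute)

text \<open>A crude bound for the operator norm with respect to the maximum norm; the summand \<open>1\<close> makes
  it safe to divide by and absorbs the carry in the bound for digits.\<close>

definition mat_bound :: "int ^ 'k ^ 'k \<Rightarrow> real" where
  "mat_bound N = 1 + (\<Sum>i\<in>UNIV. \<Sum>j\<in>UNIV. \<bar>real_of_int (N $ i $ j)\<bar>)"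

lemma mat_bound_ge_1: "mat_bound N \<ge> 1"
  by (simp add: mat_bound_def sum_nonneg)

lemma abs_mult_le_mat_bound:
  fixes x :: "int ^ 'k"
  assumes "\<And>i. \<bar>real_of_int (x $ i)\<bar> \<le> c" "c \<ge> 0"
  shows "\<bar>real_of_int ((x v* N) $ j)\<bar> \<le> mat_bound N * c"
proof -
  have "\<bar>real_of_int ((x v* N) $ j)\<bar> \<le> (\<Sum>i\<in>UNIV. \<bar>real_of_int (x $ i * N $ i $ j)\<bar>)"
    unfolding vector_matrix_mult_def vec_lambda_beta of_int_sum by (rule sum_abs)
  also have "\<dots> \<le> (\<Sum>i\<in>UNIV. (\<Sum>l\<in>UNIV. \<bar>real_of_int (N $ i $ l)\<bar>) * c)"
  proof (rule sum_mono)
    fix i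
    have "\<bar>real_of_int (N $ i $ j)\<bar> \<le> (\<Sum>l\<in>UNIV. \<bar>real_of_int (N $ i $ l)\<bar>)"
      by (rule member_le_sum) auto
    then show "\<bar>real_of_int (x $ i * N $ i $ j)\<bar> \<le> (\<Sum>l\<in>UNIV. \<bar>real_of_int (N $ i $ l)\<bar>) * c"
      unfolding of_int_mult abs_mult mult.commute[of "\<bar>real_of_int (x $ i)\<bar>"]
      using assms by (intro mult_mono) (auto intro: sum_nonneg)
  qed
  also have "\<dots> \<le> mat_bound N * c"
    using assms(2) by (simp add: mat_bound_def distrib_right sum_distrib_right)
  finally show ?thesis .
qed

text \<open>After division by \<open>p\<close>, \<open>lift_at\<close> is the point of the torus orbit of \<open>\<beta> \<alpha> / p\<close> under \<open>C\<close> at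
  time \<open>w\<close>, lifted to the unit cube around the origin, and \<open>digit\<close> is the lattice vector that
  is subtracted when the next image is brought back to that cube. The factor \<open>\<beta>\<close> will be \<open>det B\<close>:
  it clears the denominators of the inverse of \<open>B\<close>.\<close>

definition lift_at :: "nat \<Rightarrow> int \<Rightarrow> int ^ 'k ^ 'k \<Rightarrow> int ^ 'k \<Rightarrow> nat \<Rightarrow> int ^ 'k" where
  "lift_at p \<beta> C \<alpha> w = (\<chi> i. sres p (\<beta> * (\<alpha> v* mat_power C w) $ i))"

definition digit :: "nat \<Rightarrow> int \<Rightarrow> int ^ 'k ^ 'k \<Rightarrow> int ^ 'k \<Rightarrow> nat \<Rightarrow> int ^ 'k" where
  "digit p \<beta> C \<alpha> w = (\<chi> i. ((lift_at p \<beta> C \<alpha> w v* C) $ i - lift_at p \<beta> C \<alpha> (Suc w) $ i) div int p)"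

lemma abs_lift_at_le: "p > 0 \<Longrightarrow> 2 * \<bar>real_of_int (lift_at p \<beta> C \<alpha> w $ i)\<bar> \<le> real p"
proof -
  assume "p > 0"
  then have "2 * \<bar>lift_at p \<beta> C \<alpha> w $ i\<bar> \<le> int p" by (simp add: lift_at_def abs_sres_le)
  then show ?thesis by linarith
qed

lemma lift_at_step:
  fixes C :: "int ^ 'k ^ 'k"
  assumes p: "p > 0"
  shows "lift_at p \<beta> C \<alpha> w v* C = int p *s digit p \<beta> C \<alpha> w + lift_at p \<beta> C \<alpha> (Suc w)"
proof -
  let ?x = "\<lambda>w. \<beta> *s (\<alpha> v* mat_power C w)"
  have red: "vec_mod (lift_at p \<beta> C \<alpha> w) p = vec_mod (?x w) p" for w
    by (simp add: vec_mod_eq_iff lift_at_def dvd_diff_sres dvd_diff_commute[of _ "sres _ _"])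
  have "?x w v* C = ?x (Suc w)"
  proof -
    have "(c *s y) v* C = c *s (y v* C)" for c and y :: "int ^ 'k"
      by (simp add: vec_eq_iff vector_matrix_mult_def sum_distrib_left mult_ac)
    then show ?thesis by (simp add: vector_matrix_mul_assoc mat_power_commute)
  qed
  then have "vec_mod (lift_at p \<beta> C \<alpha> w v* C) p = vec_mod (lift_at p \<beta> C \<alpha> (Suc w)) p"
    using vec_mod_mult_cong[OF red[of w], of C] red[of "Suc w"] by simp
  then have "int p * digit p \<beta> C \<alpha> w $ i = (lift_at p \<beta> C \<alpha> w v* C) $ i - lift_at p \<beta> C \<alpha> (Suc w) $ i" for i
    by (simp add: vec_mod_eq_iff digit_def)
  then show ?thesis by (simp add: vec_eq_iff)
qed

definition digits :: "real \<Rightarrow> (int ^ 'k) set" where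
  "digits H = {z. \<forall>i. \<bar>real_of_int (z $ i)\<bar> \<le> H}"

lemma finite_digits: "finite (digits H :: (int ^ 'k) set)"
proof (rule finite_subset)
  show "(digits H :: (int ^ 'k) set) \<subseteq> vec_lambda ` (UNIV \<rightarrow>\<^sub>E {- \<lfloor>H\<rfloor>..\<lfloor>H\<rfloor>})"
  proof
    fix x :: "int ^ 'k"
    assume "x \<in> digits H"
    then have H: "\<bar>real_of_int (x $ i)\<bar> \<le> H" for i by (simp add: digits_def)
    have "x $ i \<le> \<lfloor>H\<rfloor>" "- (x $ i) \<le> \<lfloor>H\<rfloor>" for i
      using H[of i] by (simp_all add: le_floor_iff)
    then have "vec_nth x \<in> UNIV \<rightarrow>\<^sub>E {- \<lfloor>H\<rfloor>..\<lfloor>H\<rfloor>}"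
      by (auto simp: minus_le_iff)
    then show "x \<in> vec_lambda ` (UNIV \<rightarrow>\<^sub>E {- \<lfloor>H\<rfloor>..\<lfloor>H\<rfloor>})"
      by (metis image_eqI vec_nth_inverse)
  qed
qed (simp add: finite_PiE)

lemma digit_in_digits:
  assumes p: "p > 0"
  shows "digit p \<beta> C \<alpha> w \<in> digits (mat_bound C)"
proof -
  have "\<bar>real_of_int (digit p \<beta> C \<alpha> w $ i)\<bar> \<le> mat_bound C" for i
  proof -
    let ?v = "lift_at p \<beta> C \<alpha>"
    have "real p * real_of_int (digit p \<beta> C \<alpha> w $ i) = of_int ((?v w v* C) $ i) - of_int (?v (Suc w) $ i)"
      by (simp add: lift_at_step[OF p])
    moreover have "\<bar>real_of_int ((?v w v* C) $ i)\<bar> \<le> mat_bound C * (real p / 2)"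
      using abs_lift_at_le[OF p, of \<beta> C \<alpha> w] by (intro abs_mult_le_mat_bound) (auto simp: field_simps)
    moreover have "real p / 2 \<le> mat_bound C * (real p / 2)"
      using mult_right_mono[OF mat_bound_ge_1, of "real p / 2" C] by simp
    ultimately have "\<bar>real p * real_of_int (digit p \<beta> C \<alpha> w $ i)\<bar> \<le> real p * mat_bound C"
      using abs_lift_at_le[OF p, of \<beta> C \<alpha> "Suc w" i] by (simp add: mult.commute)
    then show ?thesis using p by (simp add: abs_mult)
  qed
  then show ?thesis by (simp add: digits_def)
qed

text \<open>A short lift has an image shorter than \<open>p / 2\<close>, which already is a symmetric residue, so there is
  nothing to subtract.\<close>

lemma digit_eq_0:
  assumes p: "p > 0"
    and small: "\<And>i. 2 * mat_bound C * \<bar>real_of_int (lift_at p \<beta> C \<alpha> w $ i)\<bar> < real p"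
  shows "digit p \<beta> C \<alpha> w = 0"
proof -
  let ?v = "lift_at p \<beta> C \<alpha>" and ?H = "mat_bound C"
  have H: "?H > 0" using mat_bound_ge_1[of C] by linarith
  define c where "c = Max (range (\<lambda>i. \<bar>real_of_int (?v w $ i)\<bar>))"
  have "c \<in> range (\<lambda>i. \<bar>real_of_int (?v w $ i)\<bar>)" unfolding c_def by (rule Max_in) auto
  with small have c: "2 * ?H * c < real p" "c \<ge> 0" by auto
  have le_c: "\<bar>real_of_int (?v w $ i)\<bar> \<le> c" for i by (simp add: c_def)
  have vC: "2 * \<bar>real_of_int ((?v w v* C) $ i)\<bar> < real p" for i
    using c(1) abs_mult_le_mat_bound[OF le_c c(2), of C i] unfolding mult.assoc by linarith
  have "digit p \<beta> C \<alpha> w $ i = 0" for i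
  proof -
    have "real p * \<bar>real_of_int (digit p \<beta> C \<alpha> w $ i)\<bar>
        = \<bar>real_of_int ((?v w v* C) $ i) - real_of_int (?v (Suc w) $ i)\<bar>"
      by (simp add: lift_at_step[OF p] abs_mult)
    also have "\<dots> < real p * 1" using vC[of i] abs_lift_at_le[OF p, of \<beta> C \<alpha> "Suc w" i] by linarith
    finally show ?thesis using p by simp
  qed
  then show ?thesis by (simp add: vec_eq_iff)
qed

text \<open>If two frequencies share their first \<open>t\<close> digits, then the difference of their lifts is
  multiplied by \<open>C\<close> exactly at each of these steps. Since \<open>C\<close> at least doubles the maximum norm and the
  difference stays below \<open>p < 2\<^sup>t\<close>, it is less than \<open>1\<close> at the start.\<close>

lemma digit_inj:
  fixes C :: "int ^ 'k ^ 'k"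
  assumes p: "p > 0" "p < 2 ^ t" and \<beta>: "coprime \<beta> (int p)"
    and expand: "\<And>(x :: int ^ 'k) L i.
      (\<And>j. \<bar>real_of_int ((x v* C) $ j)\<bar> \<le> L) \<Longrightarrow> 2 * \<bar>real_of_int (x $ i)\<bar> \<le> L"
    and eq: "\<And>w. w < t \<Longrightarrow> digit p \<beta> C \<alpha> w = digit p \<beta> C \<alpha>' w"
  shows "vec_mod \<alpha> p = vec_mod \<alpha>' p"
proof -
  define u where "u w = lift_at p \<beta> C \<alpha> w - lift_at p \<beta> C \<alpha>' w" for w
  have step: "u w v* C = u (Suc w)" if "w < t" for w
    by (simp add: u_def vector_matrix_mult_diff_distrib lift_at_step[OF p(1)] eq[OF that])
  have bound: "2 ^ m * \<bar>real_of_int (u (t - m) $ i)\<bar> \<le> p" if "m \<le> t" for m i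
    using that
  proof (induction m arbitrary: i)
    case 0
    show ?case
      using abs_lift_at_le[OF p(1), of \<beta> C \<alpha> t i] abs_lift_at_le[OF p(1), of \<beta> C \<alpha>' t i]
      by (simp add: u_def)
  next
    case (Suc m)
    have "t - m = Suc (t - Suc m)" using Suc.prems by simp
    then have st: "u (t - Suc m) v* C = u (t - m)" using step[of "t - Suc m"] Suc.prems by simp
    have "\<bar>real_of_int ((u (t - Suc m) v* C) $ j)\<bar> \<le> p / 2 ^ m" for j
      using Suc by (simp add: st field_simps)
    from expand[OF this] show ?case by (simp add: field_simps)
  qed
  have "u 0 $ i = 0" for i
  proof -
    have "real p < 2 ^ t"
      using p(2) by (metis of_nat_less_iff of_nat_power of_nat_numeral)
    then have "2 ^ t * \<bar>real_of_int (u 0 $ i)\<bar> < 2 ^ t * 1"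
      using bound[OF order_refl, of i] unfolding diff_self_eq_0 mult_1_right by linarith
    then show ?thesis by simp
  qed
  then have "sres p (\<beta> * \<alpha> $ i) = sres p (\<beta> * \<alpha>' $ i)" for i
    by (simp add: u_def lift_at_def)
  then have "int p dvd \<beta> * \<alpha> $ i - \<beta> * \<alpha>' $ i" for i
    using dvd_diff[OF dvd_diff_sres[of p "\<beta> * \<alpha> $ i"] dvd_diff_sres[of p "\<beta> * \<alpha>' $ i"]] by simp
  then have "int p dvd \<beta> * (\<alpha> $ i - \<alpha>' $ i)" for i by (simp add: right_diff_distrib)
  then show ?thesis
    using \<beta> by (simp add: vec_mod_eq_iff coprime_commute coprime_dvd_mult_right_iff)
qed

lemma digit_zero: "p > 0 \<Longrightarrow> digit p \<beta> C 0 w = 0"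
  by (simp add: digit_def lift_at_def vec_eq_iff sres_def vector_matrix_mult_def)

text \<open>A sum over frequencies becomes a sum over strings of digits, which factorises.\<close>

lemma sum_digit_weights:
  fixes C :: "int ^ 'k ^ 'k" and c :: real
  assumes p: "p > 0" "p < 2 ^ t" and \<beta>: "coprime \<beta> (int p)"
    and expand: "\<And>(x :: int ^ 'k) L i.
      (\<And>j. \<bar>real_of_int ((x v* C) $ j)\<bar> \<le> L) \<Longrightarrow> 2 * \<bar>real_of_int (x $ i)\<bar> \<le> L"
    and c: "0 \<le> c"
  shows "(\<Sum>\<alpha>\<in>residue_vectors p - {0}. \<Prod>w<t. if digit p \<beta> C \<alpha> w = 0 then 1 else c)
    \<le> (1 + card (digits (mat_bound C) :: (int ^ 'k) set) * c) ^ t - 1"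
proof -
  let ?R = "residue_vectors p :: (int ^ 'k) set" and ?Z = "digits (mat_bound C) :: (int ^ 'k) set"
  let ?wt = "\<lambda>z :: int ^ 'k. if z = 0 then 1 else c"
  let ?ds = "\<lambda>\<alpha>. \<lambda>w\<in>{..<t}. digit p \<beta> C \<alpha> w"
  have zero: "0 \<in> ?Z" using mat_bound_ge_1[of C] by (simp add: digits_def)
  have inj: "inj_on ?ds ?R"
  proof (rule inj_onI)
    fix \<alpha> \<alpha>' assume in_R: "\<alpha> \<in> ?R" "\<alpha>' \<in> ?R" and "?ds \<alpha> = ?ds \<alpha>'"
    then have "digit p \<beta> C \<alpha> w = digit p \<beta> C \<alpha>' w" if "w < t" for w
      using that by (metis restrict_apply lessThan_iff)
    then have "vec_mod \<alpha> p = vec_mod \<alpha>' p"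
      by (intro digit_inj[OF p \<beta>, of C]) (rule expand)
    then show "\<alpha> = \<alpha>'" by (rule vec_mod_eqI[OF in_R])
  qed
  have "(\<Sum>\<alpha>\<in>?R. \<Prod>w<t. ?wt (digit p \<beta> C \<alpha> w)) = (\<Sum>\<alpha>\<in>?R. \<Prod>w<t. ?wt (?ds \<alpha> w))"
    by simp
  also have "\<dots> = (\<Sum>g\<in>?ds ` ?R. \<Prod>w<t. ?wt (g w))"
    by (simp add: sum.reindex[OF inj])
  also have "\<dots> \<le> (\<Sum>g\<in>{..<t} \<rightarrow>\<^sub>E ?Z. \<Prod>w<t. ?wt (g w))"
  proof (rule sum_mono2)
    show "?ds ` ?R \<subseteq> {..<t} \<rightarrow>\<^sub>E ?Z"
      using digit_in_digits[OF p(1)] by (simp only: restrict_PiE_iff image_subset_iff) blast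
  qed (use c in \<open>auto simp: finite_PiE finite_digits intro!: prod_nonneg\<close>)
  also have "\<dots> = (\<Prod>w<t. \<Sum>z\<in>?Z. ?wt z)"
    by (intro prod_sum_PiE[symmetric]) (simp_all add: finite_digits)
  also have "\<dots> = (\<Sum>z\<in>?Z. ?wt z) ^ t" by simp
  also have "(\<Sum>z\<in>?Z. ?wt z) = 1 + (\<Sum>z\<in>?Z - {0}. c)"
    by (subst sum.remove[OF finite_digits zero]) (auto intro: sum.cong)
  also have "(1 + (\<Sum>z\<in>?Z - {0}. c)) ^ t \<le> (1 + card ?Z * c) ^ t"
    using c by (intro power_mono add_left_mono)
      (auto intro!: mult_right_mono add_nonneg_nonneg simp: card_Diff_subset zero)
  finally have "(\<Sum>\<alpha>\<in>?R. \<Prod>w<t. ?wt (digit p \<beta> C \<alpha> w)) \<le> (1 + card ?Z * c) ^ t" .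
  then show ?thesis
    using zero_in_residue_vectors[OF p(1)] by (subst (asm) sum.remove[of ?R 0]) (simp_all add: digit_zero[OF p(1)])
qed


section \<open>Values of the characteristic function away from \<open>1\<close>\<close>

lemma norm_chi_add:
  "cmod (chi p a + chi p b) = 2 * \<bar>cos (pi * (real_of_int (a - b) / real p))\<bar>"
proof -
  define x where "x = pi * (real_of_int (a - b) / real p)"
  have ab: "a = b + (a - b)" by simp
  have "chi p (a - b) = cis (2 * x)" by (simp add: chi_def x_def mult.assoc)
  then have "chi p a + chi p b = chi p b * (cis (2 * x) + 1)"
    by (subst ab, subst chi_add) (simp add: algebra_simps)
  also have "cis (2 * x) + 1 = complex_of_real (2 * cos x) * cis x"
    by (simp add: complex_eq_iff cos_double_cos sin_double power2_eq_square)
  finally show ?thesis by (simp add: norm_mult x_def)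
qed

text \<open>Equal masses \<open>min (pmf \<mu> h) (pmf \<mu> k)\<close> at \<open>h\<close> and \<open>k\<close> are paired off and cancel partially; the
  triangle inequality takes care of the remaining mass.\<close>

lemma norm_char_pmf_le:
  assumes "h \<noteq> k"
  shows "cmod (char_pmf p \<mu> \<alpha>)
    \<le> 1 - min (pmf \<mu> h) (pmf \<mu> k) * (2 - cmod (chi p (dot \<alpha> h) + chi p (dot \<alpha> k)))"
proof -
  let ?e = "\<lambda>x. chi p (dot \<alpha> x)"
  define m where "m = min (pmf \<mu> h) (pmf \<mu> k)"
  have int: "integrable (measure_pmf \<mu>) (\<lambda>x. indicat_real S x *\<^sub>R ?e x)" for S
    by (rule measure_pmf.integrable_const_bound[of _ 1]) (auto simp: indicator_def)
  have "char_pmf p \<mu> \<alpha> = measure_pmf.expectation \<mu>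
      (\<lambda>x. indicat_real {h, k} x *\<^sub>R ?e x + indicat_real (- {h, k}) x *\<^sub>R ?e x)"
    unfolding char_pmf_def by (intro Bochner_Integration.integral_cong) (auto simp: indicator_def)
  also have "\<dots> = measure_pmf.expectation \<mu> (\<lambda>x. indicat_real {h, k} x *\<^sub>R ?e x)
      + measure_pmf.expectation \<mu> (\<lambda>x. indicat_real (- {h, k}) x *\<^sub>R ?e x)"
    by (rule Bochner_Integration.integral_add[OF int int])
  also have "measure_pmf.expectation \<mu> (\<lambda>x. indicat_real {h, k} x *\<^sub>R ?e x)
      = (\<Sum>x\<in>{h, k}. pmf \<mu> x *\<^sub>R (indicat_real {h, k} x *\<^sub>R ?e x))"
    by (rule integral_measure_pmf) (auto simp: indicator_def)
  also have "\<dots> = m *\<^sub>R (?e h + ?e k) + ((pmf \<mu> h - m) *\<^sub>R ?e h + (pmf \<mu> k - m) *\<^sub>R ?e k)"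
    using assms by (simp add: algebra_simps)
  finally have split: "char_pmf p \<mu> \<alpha>
      = m *\<^sub>R (?e h + ?e k) + ((pmf \<mu> h - m) *\<^sub>R ?e h + (pmf \<mu> k - m) *\<^sub>R ?e k)
        + measure_pmf.expectation \<mu> (\<lambda>x. indicat_real (- {h, k}) x *\<^sub>R ?e x)" .
  have "cmod (measure_pmf.expectation \<mu> (\<lambda>x. indicat_real (- {h, k}) x *\<^sub>R ?e x))
      \<le> measure_pmf.expectation \<mu> (\<lambda>x. norm (indicat_real (- {h, k}) x *\<^sub>R ?e x))"
    by (rule integral_norm_bound)
  also have "\<dots> = measure_pmf.prob \<mu> (- {h, k})" by simp
  also have "\<dots> = 1 - (pmf \<mu> h + pmf \<mu> k)"
    using measure_pmf.prob_compl[of "{h, k}" \<mu>] assms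
    by (simp add: Compl_eq_Diff_UNIV measure_measure_pmf_finite)
  finally have rest: "cmod (measure_pmf.expectation \<mu> (\<lambda>x. indicat_real (- {h, k}) x *\<^sub>R ?e x))
      \<le> 1 - (pmf \<mu> h + pmf \<mu> k)" .
  have m: "0 \<le> m" "m \<le> pmf \<mu> h" "m \<le> pmf \<mu> k" by (auto simp: m_def)
  have "cmod (char_pmf p \<mu> \<alpha>) \<le> cmod (m *\<^sub>R (?e h + ?e k))
      + (cmod ((pmf \<mu> h - m) *\<^sub>R ?e h) + cmod ((pmf \<mu> k - m) *\<^sub>R ?e k)) + (1 - (pmf \<mu> h + pmf \<mu> k))"
    unfolding split by (intro norm_triangle_mono order_refl rest)
  also have "\<dots> = 1 - m * (2 - cmod (?e h + ?e k))"
    unfolding norm_scaleR norm_chi using m by (simp add: algebra_simps)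
  finally show ?thesis by (simp add: m_def)
qed

text \<open>The two values of \<open>chi\<close> at \<open>h\<close> and \<open>k\<close> add up to a vector of length \<open>2 \<bar>cos (\<pi> x)\<bar>\<close>, where \<open>x\<close> is the
  distance of \<open>\<alpha> \<bullet> (h - k) / p\<close> from the nearest integer. On \<open>0 \<le> x \<le> 1/2\<close> the cosine is nonnegative and
  decreasing.\<close>

lemma norm_char_pmf_le_gap:
  assumes p: "p > 0" and hk: "h \<noteq> k" and \<eta>: "0 \<le> \<eta>"
    and far: "\<eta> * real p \<le> \<bar>real_of_int (sres p (dot \<alpha> (h - k)))\<bar>"
  shows "cmod (char_pmf p \<mu> \<alpha>) \<le> 1 - 2 * min (pmf \<mu> h) (pmf \<mu> k) * (1 - cos (pi * \<eta>))"
proof -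
  define x where "x = \<bar>real_of_int (sres p (dot \<alpha> (h - k)))\<bar> / p"
  have "chi p (dot \<alpha> h) + chi p (dot \<alpha> k) = chi p (dot \<alpha> k) * (chi p (dot \<alpha> (h - k)) + 1)"
    by (simp add: dot_diff_right distrib_left flip: chi_add)
  then have "cmod (chi p (dot \<alpha> h) + chi p (dot \<alpha> k))
      = cmod (chi p (sres p (dot \<alpha> (h - k))) + chi p 0)"
    by (simp add: norm_mult chi_sres[OF p])
  also have "\<dots> = 2 * \<bar>cos (pi * x)\<bar>"
  proof -
    have "cos (pi * (real_of_int y / real p)) = cos (pi * (\<bar>real_of_int y\<bar> / real p))" for y
      by (cases "y \<ge> 0") simp_all
    then show ?thesis unfolding norm_chi_add x_def diff_0_right by simp
  qed
  finally have eq: "cmod (chi p (dot \<alpha> h) + chi p (dot \<alpha> k)) = 2 * \<bar>cos (pi * x)\<bar>" .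
  have x: "\<eta> \<le> x" "0 \<le> x"
    using far p by (simp_all add: x_def pos_le_divide_eq)
  have "2 * \<bar>sres p (dot \<alpha> (h - k))\<bar> \<le> int p" by (rule abs_sres_le[OF p])
  then have "x \<le> 1 / 2" using p by (simp add: x_def field_simps)
  then have "pi * x \<le> pi / 2" by simp
  then have "0 \<le> cos (pi * x)" using x(2) by (intro cos_ge_zero) (auto intro: order_trans[of _ 0])
  moreover have "cos (pi * x) \<le> cos (pi * \<eta>)"
    using x \<eta> \<open>pi * x \<le> pi / 2\<close> by (intro cos_monotone_0_pi_le) (auto intro: order_trans[of _ "pi / 2"])
  ultimately have "2 - cmod (chi p (dot \<alpha> h) + chi p (dot \<alpha> k)) \<ge> 2 * (1 - cos (pi * \<eta>))"
    by (simp add: eq)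
  then have "min (pmf \<mu> h) (pmf \<mu> k) * (2 * (1 - cos (pi * \<eta>)))
      \<le> min (pmf \<mu> h) (pmf \<mu> k) * (2 - cmod (chi p (dot \<alpha> h) + chi p (dot \<alpha> k)))"
    by (intro mult_left_mono) auto
  moreover have "2 * m * (1 - c) = m * (2 * (1 - c))" for m c :: real by simp
  ultimately show ?thesis using norm_char_pmf_le[OF hk, of p \<mu> \<alpha>] by (smt (verit))
qed

text \<open>Each column of \<open>B\<close> is \<open>A\<^sup>m (h - k)\<close> with \<open>h\<close> and \<open>k\<close> in the support, and pairing it with \<open>\<gamma>\<close> is pairing
  \<open>h - k\<close> with \<open>\<gamma> A\<^sup>m\<close>. The essential point is that \<open>\<rho>\<close> and \<open>m\<close> do not depend on \<open>p\<close> and \<open>\<gamma>\<close>.\<close>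

lemma ex_uniform_gap:
  fixes A B :: "int ^ 'k ^ 'k"
  assumes cols: "\<And>j. column j B \<in> supp_orbit A \<mu>"
    and s: "degree (min_poly (of_int_mat A :: rat ^ 'k ^ 'k)) \<le> s"
    and \<eta>: "0 < \<eta>" "\<eta> < 1 / 2"
  shows "\<exists>\<rho>. 0 < \<rho> \<and> \<rho> < 1 \<and> (\<forall>j. \<exists>m<s. \<forall>p \<gamma>. p > 0 \<and>
    \<eta> * real p \<le> \<bar>real_of_int (sres p ((\<gamma> v* B) $ j))\<bar> \<longrightarrow>
      cmod (char_pmf p \<mu> (\<gamma> v* mat_power A m)) \<le> \<rho>)"
proof -
  have "\<forall>j. \<exists>\<rho><1. \<exists>m<s. \<forall>p \<gamma>. p > 0 \<and>
    \<eta> * real p \<le> \<bar>real_of_int (sres p ((\<gamma> v* B) $ j))\<bar> \<longrightarrow>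
      cmod (char_pmf p \<mu> (\<gamma> v* mat_power A m)) \<le> \<rho>"
  proof
    fix j
    obtain m h k where m: "column j B = mat_power A m *v (h - k)" "m < s"
      and hk: "h \<in> set_pmf \<mu>" "k \<in> set_pmf \<mu>"
      using cols[of j] s by (auto simp: supp_orbit_def supp_differences_def)
    have col: "(\<gamma> v* B) $ j = dot (\<gamma> v* mat_power A m) (h - k)" for \<gamma>
    proof -
      have "(\<gamma> v* B) $ j = dot \<gamma> (column j B)"
        by (simp add: vector_matrix_mult_def dot_def column_def)
      then show ?thesis by (simp add: m dot_matrix_mult)
    qed
    show "\<exists>\<rho><1. \<exists>m<s. \<forall>p \<gamma>. p > 0 \<and>
      \<eta> * real p \<le> \<bar>real_of_int (sres p ((\<gamma> v* B) $ j))\<bar> \<longrightarrow>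
        cmod (char_pmf p \<mu> (\<gamma> v* mat_power A m)) \<le> \<rho>"
    proof (cases "h = k")
      case True
      have "\<not> \<eta> * real p \<le> \<bar>real_of_int (sres p ((\<gamma> v* B) $ j))\<bar>" if "p > 0" for p \<gamma>
      proof -
        have "(\<gamma> v* B) $ j = 0" unfolding col by (simp add: True dot_def)
        then show ?thesis using that \<eta> abs_sres_min[OF that, of 0 0] by (simp add: not_le)
      qed
      then show ?thesis using m(2) by (intro exI[of _ 0]) auto
    next
      case False
      let ?\<rho> = "1 - 2 * min (pmf \<mu> h) (pmf \<mu> k) * (1 - cos (pi * \<eta>))"
      have "cos (pi * \<eta>) < cos 0"
        using \<eta> by (intro cos_monotone_0_pi) (auto simp: mult_le_cancel_left1)
      then have "?\<rho> < 1" using hk by (simp add: pmf_positive)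
      then show ?thesis
        using norm_char_pmf_le_gap[OF _ False, of _ \<eta>] \<eta> m(2) unfolding col
        by (intro exI[of _ ?\<rho>] conjI exI[of _ m]) auto
    qed
  qed
  then obtain \<rho> m where \<rho>: "\<And>j. \<rho> j < 1" "\<And>j. m j < s"
    "\<And>j p \<gamma>. p > 0 \<Longrightarrow> \<eta> * real p \<le> \<bar>real_of_int (sres p ((\<gamma> v* B) $ j))\<bar> \<Longrightarrow>
      cmod (char_pmf p \<mu> (\<gamma> v* mat_power A (m j))) \<le> \<rho> j"
    by metis
  \<comment> \<open>Including \<open>1 / 2\<close> keeps the constant positive, so that its logarithm can be divided by later.\<close>
  define \<rho>' where "\<rho>' = Max (insert (1 / 2) (range \<rho>))"
  have "\<rho>' \<in> insert (1 / 2) (range \<rho>)" unfolding \<rho>'_def by (rule Max_in) auto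
  then have "\<rho>' < 1" using \<rho>(1) by auto
  moreover have \<rho>': "1 / 2 \<le> \<rho>'" "\<rho> j \<le> \<rho>'" for j
    unfolding \<rho>'_def by (rule Max_ge; simp)+
  moreover have "0 < \<rho>'" using \<rho>'(1) by simp
  moreover have "cmod (char_pmf p \<mu> (\<gamma> v* mat_power A (m j))) \<le> \<rho>'"
    if "p > 0" "\<eta> * real p \<le> \<bar>real_of_int (sres p ((\<gamma> v* B) $ j))\<bar>" for j p \<gamma>
    using \<rho>(3)[OF that] \<rho>'(2)[of j] by (rule order_trans)
  ultimately show ?thesis using \<rho>(2) by metis
qed

section \<open>The sum over frequencies\<close>

text \<open>A lift that is long forces some entry of \<open>\<gamma> B\<close> to be far from the multiples of \<open>p\<close>, where
  \<open>\<gamma> = \<alpha> C\<^sup>w\<close>: the reduced entries of \<open>\<gamma> B\<close>, multiplied by the adjugate \<open>J\<close>, give another representative of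
  \<open>\<beta> \<gamma>\<close>, and the lift is the shortest one.\<close>

lemma lift_at_le_sres:
  fixes B C J :: "int ^ 'k ^ 'k"
  assumes p: "p > 0" and J: "B ** J = mat \<beta>"
    and small: "\<And>j. \<bar>real_of_int (sres p ((\<alpha> v* mat_power C w v* B) $ j))\<bar> \<le> c" "0 \<le> c"
  shows "\<bar>real_of_int (lift_at p \<beta> C \<alpha> w $ i)\<bar> \<le> mat_bound J * c"
proof -
  define u where "u = \<alpha> v* mat_power C w v* B"
  define u' where "u' = (\<chi> j. sres p (u $ j))"
  have "vec_mod (u v* J) p = vec_mod (u' v* J) p"
    by (intro vec_mod_mult_cong) (simp add: vec_mod_eq_iff u'_def dvd_diff_sres)
  moreover have "u v* J = \<beta> *s (\<alpha> v* mat_power C w)"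
    using J by (simp add: u_def vector_matrix_mul_assoc[of _ B J] vector_matrix_mult_mat)
  ultimately have "int p dvd \<beta> * (\<alpha> v* mat_power C w) $ i - (u' v* J) $ i"
    by (simp add: vec_mod_eq_iff)
  then have "\<bar>lift_at p \<beta> C \<alpha> w $ i\<bar> \<le> \<bar>(u' v* J) $ i\<bar>"
    by (simp add: lift_at_def abs_sres_min[OF p])
  then have "\<bar>real_of_int (lift_at p \<beta> C \<alpha> w $ i)\<bar> \<le> \<bar>real_of_int ((u' v* J) $ i)\<bar>"
    by linarith
  also have "\<dots> \<le> mat_bound J * c"
    using small by (intro abs_mult_le_mat_bound) (simp_all add: u'_def u_def)
  finally show ?thesis .
qed

lemma mat_power_mult: "mat_power (mat_power A s) w = mat_power A (s * w)"
  by (induction w) (simp_all add: mat_power_add)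

lemma prod_le_factor:
  fixes g :: "nat \<Rightarrow> real"
  assumes "\<And>j. 0 \<le> g j" "\<And>j. g j \<le> 1" "m < s"
  shows "(\<Prod>j<s. g j) \<le> g m"
proof -
  have "(\<Prod>j<s. g j) = g m * (\<Prod>j\<in>{..<s} - {m}. g j)"
    using assms(3) by (simp add: prod.remove)
  also have "\<dots> \<le> g m * 1" using assms by (intro mult_left_mono prod_le_1) auto
  finally show ?thesis by simp
qed

text \<open>In each of the \<open>t\<close> blocks of length \<open>s\<close>, a nonzero digit yields a factor at most \<open>\<rho>\<close>, and the
  other factors are at most \<open>1\<close>. The constants depend on \<open>A\<close>, \<open>B\<close> and \<open>\<mu>\<close> only.\<close>

proposition sum_char_pmf_bound:
  fixes A B :: "int ^ 'k ^ 'k"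
  assumes big: "\<forall>c :: complex. eigenvalue (of_int_mat A) c \<longrightarrow> cmod c > 1"
    and cols: "\<And>j. column j B \<in> supp_orbit A \<mu>"
  shows "\<exists>\<rho> s K. 0 < \<rho> \<and> \<rho> < 1 \<and> s > 0 \<and> K \<ge> 0 \<and> (\<forall>p t r n. p > 0 \<and> coprime (det A) (int p) \<and>
    coprime (det B) (int p) \<and> p < 2 ^ t \<and> s * t * r \<le> n \<longrightarrow>
    (\<Sum>\<alpha>\<in>residue_vectors p - {0}. \<Prod>j<n. (cmod (char_pmf p \<mu> (\<alpha> v* mat_power A j)))\<^sup>2)
      \<le> (1 + K * \<rho> ^ r) ^ t - 1)"
proof -
  obtain s where s: "max 1 (degree (min_poly (of_int_mat A :: rat ^ 'k ^ 'k))) \<le> s"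
    and expand: "\<And>(x :: int ^ 'k) L i.
      (\<And>j. \<bar>real_of_int ((x v* mat_power A s) $ j)\<bar> \<le> L) \<Longrightarrow> 2 * \<bar>real_of_int (x $ i)\<bar> \<le> L"
    using expanding_power[of A] big by meson
  define C where "C = mat_power A s"
  obtain J where J: "B ** J = mat (det B)" using ex_adjugate by blast
  \<comment> \<open>If all entries of \<open>\<gamma> B\<close> reduce to at most \<open>\<eta> p\<close>, then the lift has length at most
    \<open>p / (4 mat_bound C)\<close>, which is half of what \<open>digit_eq_0\<close> allows.\<close>
  define \<eta> where "\<eta> = 1 / (4 * mat_bound C * mat_bound J)"
  have H: "mat_bound C \<ge> 1" "mat_bound J \<ge> 1" by (rule mat_bound_ge_1)+
  have "mat_bound C * mat_bound J \<ge> 1 * 1" using H by (intro mult_mono) auto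
  then have \<eta>: "0 < \<eta>" "\<eta> < 1 / 2" by (auto simp: \<eta>_def field_simps)
  obtain \<rho> where \<rho>: "0 < \<rho>" "\<rho> < 1" and gap: "\<And>j. \<exists>m<s. \<forall>p \<gamma>. p > 0 \<and>
    \<eta> * real p \<le> \<bar>real_of_int (sres p ((\<gamma> v* B) $ j))\<bar> \<longrightarrow>
      cmod (char_pmf p \<mu> (\<gamma> v* mat_power A m)) \<le> \<rho>"
    using ex_uniform_gap[OF cols _ \<eta>, of s] s by (auto simp del: of_int_mult)
  define K :: real where "K = card (digits (mat_bound C) :: (int ^ 'k) set)"
  have "(\<Sum>\<alpha>\<in>residue_vectors p - {0}. \<Prod>j<n. (cmod (char_pmf p \<mu> (\<alpha> v* mat_power A j)))\<^sup>2)
      \<le> (1 + K * \<rho> ^ r) ^ t - 1"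
    if p: "p > 0" and cop: "coprime (det A) (int p)" "coprime (det B) (int p)"
      and t: "p < 2 ^ t" and n: "s * t * r \<le> n" for p t r n
  proof -
    define f where "f \<alpha> = (cmod (char_pmf p \<mu> \<alpha>))\<^sup>2" for \<alpha>
    have f01: "0 \<le> f \<alpha>" "f \<alpha> \<le> 1" for \<alpha>
      using norm_char_pmf_le_1[of p \<mu> \<alpha>] by (simp_all add: f_def power_le_one)
    have fcong: "f \<alpha> = f \<beta>" if "vec_mod \<alpha> p = vec_mod \<beta> p" for \<alpha> \<beta>
      using char_pmf_cong[OF p that] by (simp add: f_def)
    have block: "(\<Prod>j<s. f (\<alpha> v* mat_power A (s * w + j)))
        \<le> (if digit p (det B) C \<alpha> w = 0 then 1 else \<rho>)" for \<alpha> w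
    proof (cases "digit p (det B) C \<alpha> w = 0")
      case True
      then show ?thesis by (simp add: prod_le_1 f01)
    next
      case False
      let ?\<gamma> = "\<alpha> v* mat_power C w"
      obtain j where j: "\<eta> * real p \<le> \<bar>real_of_int (sres p ((?\<gamma> v* B) $ j))\<bar>"
      proof (rule ccontr)
        assume "\<not> thesis"
        with that have "\<bar>real_of_int (sres p ((?\<gamma> v* B) $ j))\<bar> \<le> \<eta> * real p" for j
          by (meson linear)
        from lift_at_le_sres[OF p J this] \<eta>
        have "\<bar>real_of_int (lift_at p (det B) C \<alpha> w $ i)\<bar> \<le> mat_bound J * (\<eta> * real p)" for i
          by simp
        then have "2 * mat_bound C * \<bar>real_of_int (lift_at p (det B) C \<alpha> w $ i)\<bar>
            \<le> 2 * mat_bound C * (mat_bound J * (\<eta> * real p))" for i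
          using H by (intro mult_left_mono) auto
        also have "2 * mat_bound C * (mat_bound J * (\<eta> * real p)) = real p / 2"
          using H by (simp add: \<eta>_def)
        also have "\<dots> < real p" using p by simp
        finally have "2 * mat_bound C * \<bar>real_of_int (lift_at p (det B) C \<alpha> w $ i)\<bar> < real p" for i .
        then have "digit p (det B) C \<alpha> w = 0" by (rule digit_eq_0[OF p])
        with False show False by contradiction
      qed
      then obtain m where m: "m < s" "cmod (char_pmf p \<mu> (?\<gamma> v* mat_power A m)) \<le> \<rho>"
        using gap[of j] p by blast
      have "?\<gamma> v* mat_power A m = \<alpha> v* mat_power A (s * w + m)"
        by (simp add: C_def mat_power_mult vector_matrix_mul_assoc mat_power_add)
      with m(2) have "cmod (char_pmf p \<mu> (\<alpha> v* mat_power A (s * w + m))) \<le> \<rho>" by simp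
      then have "f (\<alpha> v* mat_power A (s * w + m)) \<le> \<rho>"
        using power_decreasing[of 1 2 "cmod (char_pmf p \<mu> (\<alpha> v* mat_power A (s * w + m)))"]
          norm_char_pmf_le_1[of p \<mu> "\<alpha> v* mat_power A (s * w + m)"] by (simp add: f_def)
      moreover have "(\<Prod>j<s. f (\<alpha> v* mat_power A (s * w + j))) \<le> f (\<alpha> v* mat_power A (s * w + m))"
        by (rule prod_le_factor[OF _ _ m(1)]) (simp_all add: f01)
      ultimately show ?thesis using False by simp
    qed
    have blocks: "(\<Prod>j<s * t. f (\<alpha> v* mat_power A j)) ^ r
        \<le> (\<Prod>w<t. if digit p (det B) C \<alpha> w = 0 then 1 else \<rho> ^ r)" for \<alpha>
    proof -
      have "(\<Prod>j<s * t. f (\<alpha> v* mat_power A j))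
          \<le> (\<Prod>w<t. if digit p (det B) C \<alpha> w = 0 then 1 else \<rho>)"
        unfolding prod_lessThan_mult
        by (intro prod_mono conjI block prod_nonneg) (simp add: f01)
      then have "(\<Prod>j<s * t. f (\<alpha> v* mat_power A j)) ^ r
          \<le> (\<Prod>w<t. if digit p (det B) C \<alpha> w = 0 then 1 else \<rho>) ^ r"
        by (intro power_mono prod_nonneg) (simp_all add: f01)
      also have "\<dots> = (\<Prod>w<t. if digit p (det B) C \<alpha> w = 0 then 1 else \<rho> ^ r)"
        unfolding prod_power_distrib by (intro prod.cong) auto
      finally show ?thesis .
    qed
    have "(\<Sum>\<alpha>\<in>residue_vectors p - {0}. \<Prod>j<n. f (\<alpha> v* mat_power A j))
        \<le> (\<Sum>\<alpha>\<in>residue_vectors p - {0}. (\<Prod>j<s * t. f (\<alpha> v* mat_power A j)) ^ r)"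
      using sum_prod_le_sum_block_power[OF p cop(1) f01 fcong n] .
    also have "\<dots> \<le> (\<Sum>\<alpha>\<in>residue_vectors p - {0}.
        \<Prod>w<t. if digit p (det B) C \<alpha> w = 0 then 1 else \<rho> ^ r)"
      by (intro sum_mono blocks)
    also have "\<dots> \<le> (1 + K * \<rho> ^ r) ^ t - 1"
      unfolding K_def by (rule sum_digit_weights[OF p t cop(2)]) (use \<rho> in \<open>auto simp: C_def intro: expand\<close>)
    finally show ?thesis by (simp add: f_def)
  qed
  moreover have "s > 0" "K \<ge> 0" using s by (simp_all add: K_def)
  ultimately show ?thesis using \<rho> by blast
qed

section \<open>Choice of the block lengths\<close>

text \<open>The number \<open>t\<close> of digits has to satisfy \<open>2\<^sup>t > p\<close>, and \<open>2 ln p\<close> exceeds the binary logarithm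
  of \<open>p\<close>. The number \<open>r\<close> of repetitions is chosen so that \<open>\<rho>\<^sup>r\<close> is of order \<open>1 / (ln p)\<^sup>2\<close>, which beats \<open>t\<close>.
  For \<open>p = 2\<close> the double logarithm is negative and \<open>r = 0\<close>.\<close>

definition digit_count :: "nat \<Rightarrow> nat" where
  "digit_count p = nat \<lceil>2 * ln (real p)\<rceil>"

definition repetitions :: "real \<Rightarrow> nat \<Rightarrow> nat" where
  "repetitions \<rho> p = nat \<lfloor>- 2 / ln \<rho> * ln (ln (real p))\<rfloor>"

lemma ln_ge_two_thirds:
  assumes "p \<ge> 2"
  shows "2 / 3 \<le> ln (real p)"
proof -
  have "ln 2 \<le> ln (real p)" using assms by simp
  then show ?thesis using ln2_ge_two_thirds by linarith
qed

lemma less_two_power_digit_count: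
  assumes "p \<ge> 2"
  shows "p < 2 ^ digit_count p"
proof -
  have l: "0 < ln (real p)" using ln_ge_two_thirds[OF assms] by simp
  have t: "2 * ln (real p) \<le> real (digit_count p)" unfolding digit_count_def by linarith
  have "ln (real p) < 4 / 3 * ln (real p)" using l by simp
  also have "\<dots> \<le> 2 * ln (real p) * ln 2"
    using mult_left_mono[OF ln2_ge_two_thirds, of "2 * ln (real p)"] l by simp
  also have "\<dots> \<le> real (digit_count p) * ln 2" using t by (intro mult_right_mono) auto
  also have "\<dots> = ln (2 ^ digit_count p)" by (simp add: ln_realpow)
  finally have "real p < 2 ^ digit_count p" using assms by (subst (asm) ln_less_cancel_iff) auto
  then show ?thesis by (metis of_nat_less_iff of_nat_power of_nat_numeral)
qed

lemma digit_count_le: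
  assumes "p \<ge> 2"
  shows "real (digit_count p) \<le> 4 * ln (real p)"
  using ln_ge_two_thirds[OF assms] unfolding digit_count_def by linarith

lemma block_time_le:
  assumes \<rho>: "0 < \<rho>" "\<rho> < 1" and p: "p \<ge> 2"
    and n: "real n \<ge> (8 * real s / - ln \<rho>) * ln (real p) * ln (ln (real p))"
  shows "s * digit_count p * repetitions \<rho> p \<le> n"
proof (cases "ln (ln (real p)) \<le> 0")
  case True
  then have "- 2 / ln \<rho> * ln (ln (real p)) \<le> 0"
    using \<rho> by (intro mult_nonneg_nonpos) (auto simp: divide_nonpos_neg)
  then have "repetitions \<rho> p = 0" unfolding repetitions_def by linarith
  then show ?thesis by simp
next
  case False
  have r0: "0 \<le> - 2 / ln \<rho> * ln (ln (real p))"
    using False \<rho> by (intro mult_nonneg_nonneg) (auto simp: divide_nonpos_neg)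
  then have r: "real (repetitions \<rho> p) \<le> - 2 / ln \<rho> * ln (ln (real p))"
    unfolding repetitions_def by (simp add: le_floor_iff)
  have "real (s * digit_count p * repetitions \<rho> p)
      \<le> real s * (4 * ln (real p)) * (- 2 / ln \<rho> * ln (ln (real p)))"
    using r r0 digit_count_le[OF p] ln_ge_two_thirds[OF p]
    unfolding of_nat_mult by (intro mult_mono mult_nonneg_nonneg) auto
  also have "\<dots> = (8 * real s / - ln \<rho>) * ln (real p) * ln (ln (real p))" by simp
  also have "\<dots> \<le> real n" by (rule n)
  finally show ?thesis by linarith
qed

lemma power_repetitions_le:
  assumes \<rho>: "0 < \<rho>" "\<rho> < 1" and p: "p \<ge> 2"
  shows "\<rho> ^ repetitions \<rho> p \<le> 1 / \<rho> / (ln (real p))\<^sup>2"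
proof -
  let ?x = "- 2 / ln \<rho> * ln (ln (real p))"
  have l: "0 < ln (real p)" using ln_ge_two_thirds[OF p] by simp
  have ln\<rho>: "ln \<rho> < 0" using \<rho> by simp
  have "?x - 1 \<le> real (repetitions \<rho> p)" unfolding repetitions_def by linarith
  then have "\<rho> powr real (repetitions \<rho> p) \<le> \<rho> powr (?x - 1)"
    using \<rho> by (intro powr_mono') auto
  also have "\<dots> = exp (ln (ln (real p)) * (- 2) - ln \<rho>)"
    using \<rho> ln\<rho> by (simp add: powr_def algebra_simps)
  also have "\<dots> = 1 / \<rho> / (ln (real p))\<^sup>2"
  proof -
    have "exp (2 * ln (ln (real p))) = (ln (real p))\<^sup>2" using l by (simp add: exp_double)
    then show ?thesis using \<rho> by (simp add: exp_diff exp_minus mult.commute[of _ 2] divide_simps)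
  qed
  finally show ?thesis using \<rho> by (simp add: powr_realpow)
qed

lemma bound_tendsto_0:
  assumes \<rho>: "0 < \<rho>" "\<rho> < 1" and K: "K \<ge> 0"
  shows "(\<lambda>p. sqrt ((1 + K * \<rho> ^ repetitions \<rho> p) ^ digit_count p - 1) / 2) \<longlonglongrightarrow> 0"
proof -
  let ?u = "\<lambda>p :: nat. 4 * K / \<rho> / ln (real p)"
  have "?u \<longlonglongrightarrow> 0"
    by (intro tendsto_divide_0[OF tendsto_const] filterlim_at_top_imp_at_infinity
        filterlim_compose[OF ln_at_top filterlim_real_sequentially])
  then have "(\<lambda>p. sqrt (exp (?u p) - 1) / 2) \<longlonglongrightarrow> sqrt (exp 0 - 1) / 2"
    by (intro tendsto_intros) auto
  then have lim: "(\<lambda>p. sqrt (exp (?u p) - 1) / 2) \<longlonglongrightarrow> 0" by simp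
  show ?thesis
  proof (rule tendsto_sandwich[OF _ _ tendsto_const lim])
    show "\<forall>\<^sub>F p in sequentially.
        0 \<le> sqrt ((1 + K * \<rho> ^ repetitions \<rho> p) ^ digit_count p - 1) / 2"
      using \<rho> K by (intro always_eventually allI) simp
    show "\<forall>\<^sub>F p in sequentially.
        sqrt ((1 + K * \<rho> ^ repetitions \<rho> p) ^ digit_count p - 1) / 2 \<le> sqrt (exp (?u p) - 1) / 2"
      using eventually_ge_at_top[of 2]
    proof eventually_elim
      case (elim p)
      let ?y = "K * \<rho> ^ repetitions \<rho> p"
      have l: "0 < ln (real p)" using ln_ge_two_thirds[OF elim] by simp
      have y: "0 \<le> ?y" using \<rho> K by simp
      have "(1 + ?y) ^ digit_count p \<le> exp ?y ^ digit_count p"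
        using y by (intro power_mono) auto
      also have "\<dots> = exp (real (digit_count p) * ?y)" by (simp add: exp_of_nat_mult)
      also have "real (digit_count p) * ?y \<le> 4 * ln (real p) * (K * (1 / \<rho> / (ln (real p))\<^sup>2))"
        using digit_count_le[OF elim] power_repetitions_le[OF \<rho> elim] K \<rho> l
        by (intro mult_mono mult_left_mono) auto
      also have "\<dots> = ?u p" using l by (simp add: power2_eq_square)
      finally show ?case by simp
    qed
  qed
qed

section \<open>Convergence to the uniform distribution\<close>

theorem theorem3p4:
  fixes A B :: "int ^ 'k ^ 'k"
    and \<mu> :: "(int ^ 'k) pmf"
    and M :: "'w measure"
    and b :: "nat \<Rightarrow> 'w \<Rightarrow> int ^ 'k"
    and x0 :: "int ^ 'k"
  assumes A_GL: "invertible (of_int_mat A :: rat ^ 'k ^ 'k)"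
    and eigenvalues: "\<And>c :: complex. eigenvalue (of_int_mat A) c \<Longrightarrow>
      \<exists>l\<ge>1. \<exists>N::nat. N \<ge> 2 \<and> c ^ l = of_nat N"
    and support: "\<not> (\<exists>W :: (rat ^ 'k) set. vec.subspace W \<and> W \<noteq> UNIV \<and>
      invariant_under (of_int_mat A) W \<and> parallel_to (of_int_vec ` set_pmf \<mu>) W)"
    and prob: "prob_space M"
    and indep: "prob_space.indep_vars M (\<lambda>_. count_space UNIV) b UNIV"
    and law: "\<And>n. distr M (count_space UNIV) (b n) = measure_pmf \<mu>"
    and B_columns: "\<And>j. column j B \<in> supp_orbit A \<mu>"
    and B_basis: "is_basis (\<lambda>j. of_int_vec (column j B) :: rat ^ 'k)"
  shows "\<exists>c :: real. c > 0 \<and> (\<exists>\<epsilon> :: nat \<Rightarrow> real. \<epsilon> \<longlonglongrightarrow> 0 \<and>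
    (\<forall>p n. p \<ge> 2 \<and> gcd (det A) (int p) = 1 \<and> gcd (det B) (int p) = 1 \<and>
       real n \<ge> c * ln (real p) * ln (ln (real p)) \<longrightarrow>
       variation_distance p (walk_law M A b x0 p n) (uniform_law p) \<le> \<epsilon> p))"
proof -
  have big: "\<forall>c :: complex. eigenvalue (of_int_mat A) c \<longrightarrow> cmod c > 1"
  proof (intro allI impI, rule ccontr)
    fix c :: complex
    assume ev: "eigenvalue (of_int_mat A) c"
    assume "\<not> cmod c > 1"
    then have "cmod (c ^ l) \<le> 1" for l by (simp add: norm_power power_le_one)
    moreover obtain l N where N: "c ^ l = of_nat N" "N \<ge> 2" using eigenvalues[OF ev] by blast
    ultimately have "cmod (of_nat N) \<le> 1" by metis
    with N(2) show False by simp
  qed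
  obtain \<rho> s K where \<rho>: "0 < \<rho>" "\<rho> < 1" and s: "s > 0" and K: "K \<ge> 0"
    and bound: "\<forall>p t r n. p > 0 \<and> coprime (det A) (int p) \<and>
      coprime (det B) (int p) \<and> p < 2 ^ t \<and> s * t * r \<le> n \<longrightarrow>
      (\<Sum>\<alpha>\<in>residue_vectors p - {0}. \<Prod>j<n. (cmod (char_pmf p \<mu> (\<alpha> v* mat_power A j)))\<^sup>2)
        \<le> (1 + K * \<rho> ^ r) ^ t - 1"
    using sum_char_pmf_bound[OF big B_columns] by (elim exE conjE) (rule that)
  let ?c = "8 * real s / - ln \<rho>"
  let ?\<epsilon> = "\<lambda>p. sqrt ((1 + K * \<rho> ^ repetitions \<rho> p) ^ digit_count p - 1) / 2"
  have "?c > 0" using \<rho> s by (simp add: divide_pos_neg)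
  moreover have "variation_distance p (walk_law M A b x0 p n) (uniform_law p) \<le> ?\<epsilon> p"
    if p: "p \<ge> 2" and cop: "gcd (det A) (int p) = 1" "gcd (det B) (int p) = 1"
      and n: "real n \<ge> ?c * ln (real p) * ln (ln (real p))" for p n
  proof -
    let ?V = "variation_distance p (walk_law M A b x0 p n) (uniform_law p)"
    have "4 * ?V\<^sup>2 \<le> (\<Sum>\<alpha>\<in>residue_vectors p - {0}.
        \<Prod>j<n. (cmod (char_pmf p \<mu> (\<alpha> v* mat_power A j)))\<^sup>2)"
      using p by (intro prob_space.variation_distance_walk_bound[OF prob _ indep law]) simp
    also have "\<dots> \<le> (1 + K * \<rho> ^ repetitions \<rho> p) ^ digit_count p - 1"
      using p cop less_two_power_digit_count[OF p] block_time_le[OF \<rho> p n]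
      by (intro bound[rule_format]) (simp add: coprime_iff_gcd_eq_1)
    finally have "4 * ?V\<^sup>2 \<le> (1 + K * \<rho> ^ repetitions \<rho> p) ^ digit_count p - 1" .
    then have "(2 * ?V)\<^sup>2 \<le> (1 + K * \<rho> ^ repetitions \<rho> p) ^ digit_count p - 1"
      by (simp add: power_mult_distrib)
    from real_le_rsqrt[OF this] show ?thesis by simp
  qed
  ultimately show ?thesis
    by (intro exI[of _ ?c] exI[of _ ?\<epsilon>] conjI bound_tendsto_0[OF \<rho> K]) auto
qed

end
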